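(* Let $A$ be a locally compact abelian group and $M$ an LC $A$-module. Then $\{0\}\subseteq \mathrm{W}^\flat(M)\subseteq \Omega^\sharp(M)\subseteq M$. If moreover $A$ is compactly generated, then $\mathrm{W}^\flat(M)$ is a compact parafinite submodule, $\Omega^\sharp(M)$ is open and $M/\Omega^\sharp(M)$ is purely discrete, and the subquotient $\Omega^\sharp(M)/\mathrm{W}^\flat(M)$ is sheer.
   Context: All topological groups are Hausdorff. An LC $A$-module is an LCA group $M$ with a continuous action of the LCA group $A$ by topological automorphisms. An LC $A$-module is compact parafinite if it is compact and has no nonzero finite quotient module; it is purely discrete if it is discrete and has no nonzero finite submodule. $\mathrm{W}^\flat(M)$ (reduced polycompact radical) is the sum of all compact parafinite submodules of $M$. $\Omega^\sharp(M)$ (augmented codiscrete radical) is the intersection of all open submodules $U\subseteq M$ such that $M/U$ is purely discrete. $M$ is sheer if $\mathrm{W}^\flat(M)=\{0\}$ and $\Omega^\sharp(M)=M$. *)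

theory Defs
  imports "HOL-Analysis.Analysis"
begin

record ('a, 'b) lcmod =
  carrier :: "'a set"
  add :: "'a \<Rightarrow> 'a \<Rightarrow> 'a"
  zero :: 'a
  neg :: "'a \<Rightarrow> 'a"
  top :: "'a topology"
  act :: "'b \<Rightarrow> 'a \<Rightarrow> 'a"

text \<open>The acting group A: an LCA group, realised as a type of class
  topological_ab_group_add (continuous addition and negation), which is Hausdorff and
  locally compact.\<close>

definition LCA_type :: "'b::{topological_ab_group_add, t2_space} itself \<Rightarrow> bool" where
  "LCA_type _ \<longleftrightarrow> locally_compact_space (euclidean :: 'b topology)"

definition gen_subgroup :: "'b::ab_group_add set \<Rightarrow> 'b set" where
  "gen_subgroup K = \<Inter>{H. K \<subseteq> H \<and> 0 \<in> H \<and> (\<forall>x\<in>H. \<forall>y\<in>H. x + y \<in> H) \<and> (\<forall>x\<in>H. - x \<in> H)}"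

definition compactly_generated :: "'b::{topological_ab_group_add} itself \<Rightarrow> bool" where
  "compactly_generated _ \<longleftrightarrow> (\<exists>K::'b set. compact K \<and> gen_subgroup K = UNIV)"

definition topological_abgroup :: "('a, 'b) lcmod \<Rightarrow> bool" where
  "topological_abgroup M \<longleftrightarrow>
     zero M \<in> carrier M \<and>
     (\<forall>x\<in>carrier M. \<forall>y\<in>carrier M. add M x y \<in> carrier M) \<and>
     (\<forall>x\<in>carrier M. neg M x \<in> carrier M) \<and>
     (\<forall>x\<in>carrier M. \<forall>y\<in>carrier M. \<forall>z\<in>carrier M. add M (add M x y) z = add M x (add M y z)) \<and>
     (\<forall>x\<in>carrier M. \<forall>y\<in>carrier M. add M x y = add M y x) \<and>
     (\<forall>x\<in>carrier M. add M (zero M) x = x) \<and>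
     (\<forall>x\<in>carrier M. add M (neg M x) x = zero M) \<and>
     topspace (top M) = carrier M \<and>
     continuous_map (prod_topology (top M) (top M)) (top M) (\<lambda>(x, y). add M x y) \<and>
     continuous_map (top M) (top M) (neg M) \<and>
     Hausdorff_space (top M)"

definition LC_module :: "('a, 'b::{topological_ab_group_add, t2_space}) lcmod \<Rightarrow> bool" where
  "LC_module M \<longleftrightarrow>
     topological_abgroup M \<and>
     locally_compact_space (top M) \<and>
     (\<forall>a. \<forall>x\<in>carrier M. act M a x \<in> carrier M) \<and>
     (\<forall>a. \<forall>x\<in>carrier M. \<forall>y\<in>carrier M. act M a (add M x y) = add M (act M a x) (act M a y)) \<and>
     (\<forall>x\<in>carrier M. act M 0 x = x) \<and>
     (\<forall>a b. \<forall>x\<in>carrier M. act M (a + b) x = act M a (act M b x)) \<and>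
     continuous_map (prod_topology euclidean (top M)) (top M) (\<lambda>(a, x). act M a x)"

definition submodule :: "('a, 'b) lcmod \<Rightarrow> 'a set \<Rightarrow> bool" where
  "submodule M N \<longleftrightarrow> N \<subseteq> carrier M \<and> zero M \<in> N \<and>
     (\<forall>x\<in>N. \<forall>y\<in>N. add M x y \<in> N) \<and> (\<forall>x\<in>N. neg M x \<in> N) \<and>
     (\<forall>a. \<forall>x\<in>N. act M a x \<in> N)"

definition submod :: "('a, 'b) lcmod \<Rightarrow> 'a set \<Rightarrow> ('a, 'b) lcmod" where
  "submod M N = M\<lparr>carrier := N, top := subtopology (top M) N\<rparr>"

definition coset :: "('a, 'b) lcmod \<Rightarrow> 'a set \<Rightarrow> 'a \<Rightarrow> 'a set" where
  "coset M N x = (\<lambda>n. add M x n) ` N"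

definition quot :: "('a, 'b) lcmod \<Rightarrow> 'a set \<Rightarrow> ('a set, 'b) lcmod" where
  "quot M N = \<lparr>carrier = coset M N ` carrier M,
               add = (\<lambda>C D. {add M x y | x y. x \<in> C \<and> y \<in> D}),
               zero = N,
               neg = (\<lambda>C. neg M ` C),
               top = topology (\<lambda>S. S \<subseteq> coset M N ` carrier M \<and> openin (top M) (\<Union>S)),
               act = (\<lambda>a C. act M a ` C)\<rparr>"

text \<open>Compact parafinite: compact, and no nonzero finite quotient module
  (a quotient module M/U, U a closed submodule so that M/U is Hausdorff).\<close>
definition compact_parafinite :: "('a, 'b) lcmod \<Rightarrow> bool" where
  "compact_parafinite M \<longleftrightarrow> compact_space (top M) \<and>
     (\<forall>U. submodule M U \<and> closedin (top M) U \<and> finite (carrier (quot M U)) \<longrightarrow> U = carrier M)"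

definition purely_discrete :: "('a, 'b) lcmod \<Rightarrow> bool" where
  "purely_discrete M \<longleftrightarrow> top M = discrete_topology (carrier M) \<and>
     (\<forall>N. submodule M N \<and> finite N \<longrightarrow> N = {zero M})"

text \<open>Reduced polycompact radical: the sum (= the submodule generated by the union)
  of all compact parafinite submodules.\<close>
definition W_flat :: "('a, 'b) lcmod \<Rightarrow> 'a set" where
  "W_flat M = \<Inter>{S. submodule M S \<and>
      (\<forall>N. submodule M N \<and> compact_parafinite (submod M N) \<longrightarrow> N \<subseteq> S)}"

definition Omega_sharp :: "('a, 'b) lcmod \<Rightarrow> 'a set" where
  "Omega_sharp M = \<Inter>{U. submodule M U \<and> openin (top M) U \<and> purely_discrete (quot M U)}"

definition sheer :: "('a, 'b) lcmod \<Rightarrow> bool" where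
  "sheer M \<longleftrightarrow> W_flat M = {zero M} \<and> Omega_sharp M = carrier M"

end

theory Submission
  imports Defs
begin

text \<open>
  Modulo finite quotients the two kinds of submodules are orthogonal: a compact submodule \<open>N\<close> is
  parafinite iff it lies in every closed submodule modulo which it is finite, and an open submodule
  \<open>U\<close> has purely discrete quotient iff it contains every submodule that is finite modulo \<open>U\<close>. A
  compact set is finite modulo an open submodule, whence \<open>W\<^sup>\<flat> \<subseteq> \<Omega>\<^sup>\<sharp>\<close>.

  Now let \<open>A\<close> be generated by a compact symmetric set \<open>K\<close>, let \<open>V\<close> be a compact neighbourhood of
  zero and \<open>P\<close> a neighbourhood of zero so small that \<open>P + P\<close>, \<open>- P\<close> and \<open>K P\<close> lie in \<open>V\<close>. If
  submodules \<open>N \<subseteq> L\<close> satisfy \<open>V \<inter> L \<subseteq> N + P\<close>, then \<open>N + (V \<inter> L)\<close> is again a submodule.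

  For \<open>N = \<Omega>\<^sup>\<sharp>\<close>, compactness of \<open>V\<close> gives a single open \<open>L\<close> with purely discrete quotient
  satisfying this; the submodule \<open>\<Omega>\<^sup>\<sharp> + (V \<inter> L)\<close> is finite modulo every such \<open>U\<close>, so
  \<open>V \<inter> L \<subseteq> \<Omega>\<^sup>\<sharp>\<close> and \<open>\<Omega>\<^sup>\<sharp>\<close> is open. For \<open>L\<close> the closure of \<open>W\<^sup>\<flat>\<close>, compactness of \<open>V \<inter> L\<close> gives a
  single compact parafinite \<open>N\<close> satisfying it; the compact submodule \<open>N + (V \<inter> L)\<close> is open in \<open>L\<close>,
  hence contains every compact parafinite submodule, so \<open>L\<close> is compact and then itself parafinite.
\<close>

section \<open>Topological preliminaries\<close>

lemma compactin_subset_directed_UN: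
  assumes compact: "compactin X S" and nonempty: "I \<noteq> {}"
    and opn: "\<And>i. i \<in> I \<Longrightarrow> openin X (B i)" and cover: "S \<subseteq> (\<Union>i\<in>I. B i)"
    and directed: "\<And>i j. i \<in> I \<Longrightarrow> j \<in> I \<Longrightarrow> \<exists>k\<in>I. B i \<union> B j \<subseteq> B k"
  obtains i where "i \<in> I" "S \<subseteq> B i"
proof -
  have upper_bound: "\<exists>k\<in>I. (\<Union>i\<in>F. B i) \<subseteq> B k" if "finite F" "F \<subseteq> I" for F
    using that
  proof (induction F rule: finite_induct)
    case empty
    then show ?case using nonempty by auto
  next
    case (insert i F)
    then obtain j where j: "j \<in> I" "(\<Union>i\<in>F. B i) \<subseteq> B j" by auto
    obtain k where "k \<in> I" "B i \<union> B j \<subseteq> B k" using directed[of i j] insert.prems j(1) by auto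
    then show ?case using j(2) by auto
  qed
  have "\<And>U. U \<in> B ` I \<Longrightarrow> openin X U" using opn by blast
  then obtain \<F> where \<F>: "finite \<F>" "\<F> \<subseteq> B ` I" "S \<subseteq> \<Union>\<F>"
    using compactinD[OF compact _ cover] by meson
  from finite_subset_image[OF \<F>(1,2)] obtain F where "F \<subseteq> I" "finite F" "\<F> = B ` F" by blast
  then obtain k where "k \<in> I" "\<Union>\<F> \<subseteq> B k" using upper_bound by blast
  then show ?thesis using \<F>(3) that by (meson subset_trans)
qed

lemma continuous_map_prod_compact_nbhd:
  assumes f: "continuous_map (prod_topology X Y) Z f" and Q: "openin Z Q"
    and K: "compactin X K" and y: "y \<in> topspace Y" and sub: "\<And>x. x \<in> K \<Longrightarrow> f (x, y) \<in> Q"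
  obtains A P where "openin X A" "openin Y P" "K \<subseteq> A" "y \<in> P"
    "\<And>a p. a \<in> A \<Longrightarrow> p \<in> P \<Longrightarrow> f (a, p) \<in> Q"
proof -
  let ?W = "{z \<in> topspace (prod_topology X Y). f z \<in> Q}"
  have W: "openin (prod_topology X Y) ?W" using f Q by (rule openin_continuous_map_preimage)
  have compact_y: "compactin Y {y}" using y by simp
  have "K \<times> {y} \<subseteq> ?W" using compactin_subset_topspace[OF K] y sub by auto
  then obtain A P where "openin X A" "openin Y P" "K \<subseteq> A" "{y} \<subseteq> P" "A \<times> P \<subseteq> ?W"
    by (rule Wallace_theorem_prod_topology[OF K compact_y W])
  then show ?thesis by (intro that[of A P]) auto
qed

lemma open_map_prod:
  assumes "open_map X X' f" "open_map Y Y' g"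
  shows "open_map (prod_topology X Y) (prod_topology X' Y') (\<lambda>(x, y). (f x, g y))"
  unfolding open_map_def
proof (intro allI impI)
  fix W assume W: "openin (prod_topology X Y) W"
  show "openin (prod_topology X' Y') ((\<lambda>(x, y). (f x, g y)) ` W)"
    unfolding openin_prod_topology_alt
  proof (intro allI impI)
    fix x' y' assume "(x', y') \<in> (\<lambda>(x, y). (f x, g y)) ` W"
    then obtain x y where xy: "(x, y) \<in> W" "x' = f x" "y' = g y" by auto
    then obtain U V where UV: "openin X U" "openin Y V" "x \<in> U" "y \<in> V" "U \<times> V \<subseteq> W"
      using W unfolding openin_prod_topology_alt by meson
    have "f ` U \<times> g ` V \<subseteq> (\<lambda>(x, y). (f x, g y)) ` W"
      using image_mono[OF UV(5)] unfolding image_paired_Times[symmetric] .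
    then show "\<exists>U' V'. openin X' U' \<and> openin Y' V' \<and> x' \<in> U' \<and> y' \<in> V' \<and>
        U' \<times> V' \<subseteq> (\<lambda>(x, y). (f x, g y)) ` W"
      using assms UV(1-4) xy(2,3) unfolding open_map_def
      by (intro exI[of _ "f ` U"] exI[of _ "g ` V"]) simp
  qed
qed

lemma quotient_map_prod_open:
  assumes f: "quotient_map X X' f" "open_map X X' f" and g: "quotient_map Y Y' g" "open_map Y Y' g"
  shows "quotient_map (prod_topology X Y) (prod_topology X' Y') (\<lambda>(x, y). (f x, g y))"
proof (rule continuous_open_imp_quotient_map)
  show "continuous_map (prod_topology X Y) (prod_topology X' Y') (\<lambda>(x, y). (f x, g y))"
    using f(1) g(1) by (simp add: continuous_map_prod_top quotient_imp_continuous_map)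
  show "open_map (prod_topology X Y) (prod_topology X' Y') (\<lambda>(x, y). (f x, g y))"
    using f(2) g(2) by (rule open_map_prod)
  have "f ` topspace X = topspace X'" "g ` topspace Y = topspace Y'"
    using f(1) g(1) by (simp_all add: quotient_map_def)
  then show "(\<lambda>(x, y). (f x, g y)) ` topspace (prod_topology X Y) = topspace (prod_topology X' Y')"
    by (simp add: image_paired_Times)
qed

section \<open>Abelian groups with an action\<close>

lemma gen_subgroup_induct [consumes 1, case_names generator zero add minus]:
  assumes "a \<in> gen_subgroup K" and "\<And>x. x \<in> K \<Longrightarrow> P x" and "P 0"
    and "\<And>x y. P x \<Longrightarrow> P y \<Longrightarrow> P (x + y)" and "\<And>x. P x \<Longrightarrow> P (- x)"
  shows "P a"
proof -
  have "gen_subgroup K \<subseteq> {x. P x}"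
    unfolding gen_subgroup_def using assms(2-) by (intro Inter_lower) auto
  then show ?thesis using assms(1) by blast
qed

lemma submodule_subset: "submodule M U \<Longrightarrow> U \<subseteq> carrier M"
  and submodule_carrier_mem: "submodule M U \<Longrightarrow> x \<in> U \<Longrightarrow> x \<in> carrier M"
  and submodule_zero_mem: "submodule M U \<Longrightarrow> zero M \<in> U"
  and submodule_add_mem: "submodule M U \<Longrightarrow> x \<in> U \<Longrightarrow> y \<in> U \<Longrightarrow> add M x y \<in> U"
  and submodule_neg_mem: "submodule M U \<Longrightarrow> x \<in> U \<Longrightarrow> neg M x \<in> U"
  and submodule_act_mem: "submodule M U \<Longrightarrow> x \<in> U \<Longrightarrow> act M a x \<in> U"
  by (auto simp: submodule_def)

lemmas submodule_mems = submodule_carrier_mem submodule_zero_mem submodule_add_mem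
  submodule_neg_mem submodule_act_mem

lemma submodule_Inter:
  "\<F> \<noteq> {} \<Longrightarrow> (\<And>U. U \<in> \<F> \<Longrightarrow> submodule M U) \<Longrightarrow> submodule M (\<Inter>\<F>)"
  unfolding submodule_def by blast

lemma submodule_Int: "submodule M U \<Longrightarrow> submodule M T \<Longrightarrow> submodule M (U \<inter> T)"
  unfolding submodule_def by blast

lemma submodule_directed_Union:
  assumes "\<F> \<noteq> {}" and sub: "\<And>U. U \<in> \<F> \<Longrightarrow> submodule M U"
    and directed: "\<And>U V. U \<in> \<F> \<Longrightarrow> V \<in> \<F> \<Longrightarrow> \<exists>W\<in>\<F>. U \<union> V \<subseteq> W"
  shows "submodule M (\<Union>\<F>)"
  unfolding submodule_def
proof (intro conjI ballI allI)
  show "\<Union>\<F> \<subseteq> carrier M" using submodule_subset[OF sub] by (rule Union_least)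
  show "zero M \<in> \<Union>\<F>" using assms(1) submodule_zero_mem[OF sub] by blast
  fix x a assume "x \<in> \<Union>\<F>"
  then obtain U where U: "U \<in> \<F>" "x \<in> U" by blast
  show "neg M x \<in> \<Union>\<F>" using U submodule_neg_mem[OF sub] by blast
  show "act M a x \<in> \<Union>\<F>" using U submodule_act_mem[OF sub] by blast
  fix y assume "y \<in> \<Union>\<F>"
  then obtain V where V: "V \<in> \<F>" "y \<in> V" by blast
  obtain W where W: "W \<in> \<F>" "U \<union> V \<subseteq> W" using directed[OF U(1) V(1)] by blast
  then have "x \<in> W" "y \<in> W" using U(2) V(2) by blast+
  then show "add M x y \<in> \<Union>\<F>" using W(1) submodule_add_mem[OF sub] by blast
qed

lemma submod_simps [simp]:
  "carrier (submod M N) = N" "top (submod M N) = subtopology (top M) N"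
  "add (submod M N) = add M" "neg (submod M N) = neg M" "zero (submod M N) = zero M"
  "act (submod M N) = act M" "coset (submod M N) = coset M"
  by (auto simp: submod_def coset_def fun_eq_iff)

lemma submod_submod: "N \<subseteq> L \<Longrightarrow> submod (submod M L) N = submod M N"
  by (simp add: submod_def subtopology_subtopology Int_absorb1)

lemma submodule_submod_iff:
  "submodule M L \<Longrightarrow> submodule (submod M L) U \<longleftrightarrow> submodule M U \<and> U \<subseteq> L"
  by (auto simp: submodule_def)

locale abgroup_action =
  fixes M :: "('a, 'b::ab_group_add) lcmod"
  assumes zero_closed [simp]: "zero M \<in> carrier M"
    and add_closed [simp]: "x \<in> carrier M \<Longrightarrow> y \<in> carrier M \<Longrightarrow> add M x y \<in> carrier M"
    and neg_closed [simp]: "x \<in> carrier M \<Longrightarrow> neg M x \<in> carrier M"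
    and add_assoc: "x \<in> carrier M \<Longrightarrow> y \<in> carrier M \<Longrightarrow> z \<in> carrier M \<Longrightarrow>
          add M (add M x y) z = add M x (add M y z)"
    and add_commute: "x \<in> carrier M \<Longrightarrow> y \<in> carrier M \<Longrightarrow> add M x y = add M y x"
    and zero_add [simp]: "x \<in> carrier M \<Longrightarrow> add M (zero M) x = x"
    and neg_add [simp]: "x \<in> carrier M \<Longrightarrow> add M (neg M x) x = zero M"
    and act_closed [simp]: "x \<in> carrier M \<Longrightarrow> act M a x \<in> carrier M"
    and act_add: "x \<in> carrier M \<Longrightarrow> y \<in> carrier M \<Longrightarrow>
          act M a (add M x y) = add M (act M a x) (act M a y)"
    and act_0 [simp]: "x \<in> carrier M \<Longrightarrow> act M 0 x = x"
    and act_act: "x \<in> carrier M \<Longrightarrow> act M (a + b) x = act M a (act M b x)"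
begin

abbreviation zero_M ("\<zero>") where "\<zero> \<equiv> zero M"
abbreviation add_M (infixl "\<oplus>" 65) where "x \<oplus> y \<equiv> add M x y"
abbreviation neg_M ("\<ominus> _" [81] 80) where "\<ominus> x \<equiv> neg M x"
abbreviation act_M (infixr "\<cdot>" 75) where "a \<cdot> x \<equiv> act M a x"

lemma add_zero [simp]: "x \<in> carrier M \<Longrightarrow> x \<oplus> \<zero> = x"
  using add_commute zero_add zero_closed by metis

lemma add_neg [simp]: "x \<in> carrier M \<Longrightarrow> x \<oplus> \<ominus> x = \<zero>"
  using add_commute neg_add neg_closed by metis

lemma add_left_commute:
  "x \<in> carrier M \<Longrightarrow> y \<in> carrier M \<Longrightarrow> z \<in> carrier M \<Longrightarrow> x \<oplus> (y \<oplus> z) = y \<oplus> (x \<oplus> z)"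
  using add_assoc add_commute by metis

lemmas add_ac = add_assoc add_commute add_left_commute

lemma neg_add_cancel [simp]: "x \<in> carrier M \<Longrightarrow> y \<in> carrier M \<Longrightarrow> \<ominus> x \<oplus> (x \<oplus> y) = y"
  by (metis add_assoc neg_add neg_closed zero_add)

lemma add_neg_cancel [simp]: "x \<in> carrier M \<Longrightarrow> y \<in> carrier M \<Longrightarrow> x \<oplus> (\<ominus> x \<oplus> y) = y"
  by (metis add_assoc add_neg neg_closed zero_add)

lemma add_diff_cancel [simp]: "x \<in> carrier M \<Longrightarrow> y \<in> carrier M \<Longrightarrow> x \<oplus> (y \<oplus> \<ominus> x) = y"
  by (simp add: add_commute[of y])

lemma add_left_cancel:
  "x \<in> carrier M \<Longrightarrow> y \<in> carrier M \<Longrightarrow> z \<in> carrier M \<Longrightarrow> x \<oplus> y = x \<oplus> z \<longleftrightarrow> y = z"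
  by (metis neg_add_cancel)

lemma neg_unique: "x \<in> carrier M \<Longrightarrow> y \<in> carrier M \<Longrightarrow> x \<oplus> y = \<zero> \<Longrightarrow> y = \<ominus> x"
  by (metis add_neg add_left_cancel neg_closed)

lemma neg_neg [simp]: "x \<in> carrier M \<Longrightarrow> \<ominus> (\<ominus> x) = x"
  by (metis neg_unique neg_add neg_closed)

lemma neg_zero [simp]: "\<ominus> \<zero> = \<zero>"
  by (metis neg_unique zero_add zero_closed)

lemma neg_add_distrib: "x \<in> carrier M \<Longrightarrow> y \<in> carrier M \<Longrightarrow> \<ominus> (x \<oplus> y) = \<ominus> x \<oplus> \<ominus> y"
  by (rule neg_unique[symmetric]) (simp_all add: add_ac)

lemma act_zero [simp]: "a \<cdot> \<zero> = \<zero>"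
  by (metis act_add act_closed add_left_cancel add_zero zero_closed)

lemma act_act_uminus [simp]: "x \<in> carrier M \<Longrightarrow> a \<cdot> - a \<cdot> x = x"
  by (simp add: act_act[symmetric])

lemma submodule_carrier [simp]: "submodule M (carrier M)"
  by (simp add: submodule_def)

lemma submodule_singleton_zero [simp]: "submodule M {\<zero>}"
  by (simp add: submodule_def)

lemma abgroup_action_submod: "submodule M N \<Longrightarrow> abgroup_action (submod M N)"
  by unfold_locales (simp_all add: submodule_mems add_ac act_add act_act)

definition sumset :: "'a set \<Rightarrow> 'a set \<Rightarrow> 'a set" (infixl "\<^bold>+" 65) where
  "S \<^bold>+ T = {x \<oplus> y | x y. x \<in> S \<and> y \<in> T}"

lemma sumsetI: "x \<in> S \<Longrightarrow> y \<in> T \<Longrightarrow> x \<oplus> y \<in> S \<^bold>+ T"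
  unfolding sumset_def by blast

lemma sumsetE:
  assumes "z \<in> S \<^bold>+ T"
  obtains x y where "z = x \<oplus> y" "x \<in> S" "y \<in> T"
  using assms unfolding sumset_def by blast

lemma sumset_eq_UN_translates: "S \<^bold>+ T = (\<Union>x\<in>S. add M x ` T)"
  unfolding sumset_def by blast

lemma sumset_mono_left: "S \<subseteq> S' \<Longrightarrow> S \<^bold>+ T \<subseteq> S' \<^bold>+ T"
  unfolding sumset_def by blast

lemma Union_sumset: "\<Union>\<F> \<^bold>+ T = (\<Union>S\<in>\<F>. S \<^bold>+ T)"
  unfolding sumset_def by blast

lemma sumset_commute: "S \<subseteq> carrier M \<Longrightarrow> T \<subseteq> carrier M \<Longrightarrow> S \<^bold>+ T = T \<^bold>+ S"
  unfolding sumset_def using add_commute by blast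

lemma sumset_subset_carrier: "S \<subseteq> carrier M \<Longrightarrow> T \<subseteq> carrier M \<Longrightarrow> S \<^bold>+ T \<subseteq> carrier M"
  by (auto elim!: sumsetE intro!: add_closed)

lemma sumset_upper1: "S \<subseteq> carrier M \<Longrightarrow> \<zero> \<in> T \<Longrightarrow> S \<subseteq> S \<^bold>+ T"
  using sumsetI[of _ S \<zero> T] by fastforce

lemma sumset_upper2: "\<zero> \<in> S \<Longrightarrow> T \<subseteq> carrier M \<Longrightarrow> T \<subseteq> S \<^bold>+ T"
  using sumsetI[of \<zero> S _ T] by fastforce

lemma Un_subset_sumset: "submodule M U \<Longrightarrow> submodule M T \<Longrightarrow> U \<union> T \<subseteq> U \<^bold>+ T"
  by (simp add: sumset_upper1 sumset_upper2 submodule_subset submodule_zero_mem)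

lemma sumset_least: "submodule M U \<Longrightarrow> S \<subseteq> U \<Longrightarrow> T \<subseteq> U \<Longrightarrow> S \<^bold>+ T \<subseteq> U"
  by (auto elim!: sumsetE simp: submodule_add_mem subset_iff)

lemma sumset_absorb:
  assumes N: "submodule M N" and T: "T \<subseteq> carrier M" and B: "B \<subseteq> N \<^bold>+ T"
  shows "N \<^bold>+ B \<subseteq> N \<^bold>+ T"
proof
  fix z assume "z \<in> N \<^bold>+ B"
  then obtain n b where z: "z = n \<oplus> b" "n \<in> N" "b \<in> B" by (rule sumsetE)
  from subsetD[OF B z(3)] obtain n' t where b: "b = n' \<oplus> t" "n' \<in> N" "t \<in> T" by (rule sumsetE)
  have "n \<in> carrier M" "n' \<in> carrier M" "t \<in> carrier M"
    using N z(2) b(2,3) T by (auto intro: submodule_carrier_mem)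
  then have "z = (n \<oplus> n') \<oplus> t" using z(1) b(1) by (simp add: add_assoc)
  then show "z \<in> N \<^bold>+ T" using z(2) b(2,3) N by (simp add: sumsetI submodule_add_mem)
qed

lemma submodule_sumset:
  assumes U: "submodule M U" and T: "submodule M T"
  shows "submodule M (U \<^bold>+ T)"
  unfolding submodule_def
proof (intro conjI ballI allI)
  show "U \<^bold>+ T \<subseteq> carrier M" using U T by (intro sumset_subset_carrier submodule_subset)
  show "\<zero> \<in> U \<^bold>+ T"
    using sumset_upper1[OF submodule_subset[OF U] submodule_zero_mem[OF T]] submodule_zero_mem[OF U]
    by blast
  fix z a assume "z \<in> U \<^bold>+ T"
  then obtain x y where z: "z = x \<oplus> y" "x \<in> U" "y \<in> T" by (rule sumsetE)
  then have xy: "x \<in> carrier M" "y \<in> carrier M" using U T by (auto intro: submodule_carrier_mem)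
  show "\<ominus> z \<in> U \<^bold>+ T" "a \<cdot> z \<in> U \<^bold>+ T"
    using z xy U T by (simp_all add: neg_add_distrib act_add sumsetI submodule_mems)
  fix z' assume "z' \<in> U \<^bold>+ T"
  then obtain x' y' where z': "z' = x' \<oplus> y'" "x' \<in> U" "y' \<in> T" by (rule sumsetE)
  then have "x' \<in> carrier M" "y' \<in> carrier M" using U T by (auto intro: submodule_carrier_mem)
  then have "z \<oplus> z' = (x \<oplus> x') \<oplus> (y \<oplus> y')" using z(1) z'(1) xy by (simp add: add_ac)
  then show "z \<oplus> z' \<in> U \<^bold>+ T" using z z' U T by (simp add: sumsetI submodule_add_mem)
qed

lemma sumset_Int_modular:
  assumes N: "submodule M N" and L: "submodule M L" "N \<subseteq> L" and P: "P \<subseteq> carrier M"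
  shows "(N \<^bold>+ P) \<inter> L = N \<^bold>+ (P \<inter> L)"
proof
  show "(N \<^bold>+ P) \<inter> L \<subseteq> N \<^bold>+ (P \<inter> L)"
  proof
    fix z assume z: "z \<in> (N \<^bold>+ P) \<inter> L"
    then obtain n p where np: "z = n \<oplus> p" "n \<in> N" "p \<in> P" by (auto elim: sumsetE)
    then have "n \<in> L" "n \<in> carrier M" "p \<in> carrier M"
      using N L(2) P by (auto intro: submodule_carrier_mem)
    then have "p = \<ominus> n \<oplus> z" "\<ominus> n \<in> L" using np L(1) by (simp_all add: submodule_neg_mem)
    then have "p \<in> L" using z submodule_add_mem[OF L(1)] by simp
    then show "z \<in> N \<^bold>+ (P \<inter> L)" using np by (simp add: sumsetI)
  qed
  show "N \<^bold>+ (P \<inter> L) \<subseteq> (N \<^bold>+ P) \<inter> L"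
    using L by (auto elim!: sumsetE intro: sumsetI submodule_add_mem)
qed

lemma act_closed_of_generators:
  assumes K: "gen_subgroup K = UNIV" "uminus ` K = K" and "H \<subseteq> carrier M"
    and act_K: "\<And>a x. a \<in> K \<Longrightarrow> x \<in> H \<Longrightarrow> a \<cdot> x \<in> H" and "x \<in> H"
  shows "a \<cdot> x \<in> H"
proof -
  have "a \<in> gen_subgroup K" using K(1) by simp
  then have "\<forall>x\<in>H. a \<cdot> x \<in> H \<and> - a \<cdot> x \<in> H"
  proof (induction rule: gen_subgroup_induct)
    case (generator a)
    then have "- a \<in> K" using K(2) by blast
    then show ?case using generator act_K by blast
  next
    case (add a b)
    have "(a + b) \<cdot> x = a \<cdot> b \<cdot> x" "- (a + b) \<cdot> x = - a \<cdot> - b \<cdot> x" if "x \<in> H" for x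
      using that assms(3) by (auto simp: act_act[symmetric])
    then show ?case using add by auto
  qed (use assms(3) in auto)
  then show ?thesis using \<open>x \<in> H\<close> by blast
qed

lemma submodule_sumset_if_small:
  assumes K: "gen_subgroup K = UNIV" "uminus ` K = K" and N: "submodule M N"
    and B: "B \<subseteq> carrier M" "\<zero> \<in> B" "B \<subseteq> N \<^bold>+ T" and T: "T \<subseteq> carrier M"
    and add_B: "\<And>x y. x \<in> T \<Longrightarrow> y \<in> T \<Longrightarrow> x \<oplus> y \<in> B" and neg_B: "\<And>x. x \<in> T \<Longrightarrow> \<ominus> x \<in> B"
    and act_B: "\<And>a x. a \<in> K \<Longrightarrow> x \<in> T \<Longrightarrow> a \<cdot> x \<in> B"
  shows "submodule M (N \<^bold>+ B)"
proof -
  have decompose: "\<exists>n t. h = n \<oplus> t \<and> n \<in> N \<and> t \<in> T \<and> n \<in> carrier M \<and> t \<in> carrier M"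
    if "h \<in> N \<^bold>+ B" for h
    using subsetD[OF sumset_absorb[OF N T B(3)] that] submodule_carrier_mem[OF N] T
    by (blast elim: sumsetE)
  have sub: "N \<^bold>+ B \<subseteq> carrier M" using submodule_subset[OF N] B(1) by (rule sumset_subset_carrier)
  have act_K: "a \<cdot> h \<in> N \<^bold>+ B" if "a \<in> K" "h \<in> N \<^bold>+ B" for a h
    using decompose[OF that(2)] that(1) N by (auto simp: act_add act_B sumsetI submodule_act_mem)
  show ?thesis
    unfolding submodule_def
  proof (intro conjI ballI allI sub)
    show "\<zero> \<in> N \<^bold>+ B"
      using sumset_upper1[OF submodule_subset[OF N] B(2)] submodule_zero_mem[OF N] by blast
    fix h a assume h: "h \<in> N \<^bold>+ B"
    show "a \<cdot> h \<in> N \<^bold>+ B" by (rule act_closed_of_generators[OF K sub act_K h])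
    obtain n t where nt: "h = n \<oplus> t" "n \<in> N" "t \<in> T" "n \<in> carrier M" "t \<in> carrier M"
      using decompose[OF h] by blast
    then show "\<ominus> h \<in> N \<^bold>+ B" using N by (simp add: neg_add_distrib neg_B sumsetI submodule_neg_mem)
    fix h' assume "h' \<in> N \<^bold>+ B"
    then obtain n' t' where nt': "h' = n' \<oplus> t'" "n' \<in> N" "t' \<in> T" "n' \<in> carrier M" "t' \<in> carrier M"
      using decompose by blast
    then have "h \<oplus> h' = (n \<oplus> n') \<oplus> (t \<oplus> t')" using nt by (simp add: add_ac)
    then show "h \<oplus> h' \<in> N \<^bold>+ B" using nt nt' N by (simp add: add_B sumsetI submodule_add_mem)
  qed
qed

lemma mem_coset_iff:
  assumes U: "submodule M U" and x: "x \<in> carrier M"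
  shows "y \<in> coset M U x \<longleftrightarrow> y \<in> carrier M \<and> y \<oplus> \<ominus> x \<in> U"
proof
  assume "y \<in> coset M U x"
  then obtain u where u: "u \<in> U" "y = x \<oplus> u" by (auto simp: coset_def)
  moreover from u have "u \<in> carrier M" using submodule_carrier_mem[OF U] by blast
  ultimately show "y \<in> carrier M \<and> y \<oplus> \<ominus> x \<in> U" using x by (simp add: add_ac)
next
  assume y: "y \<in> carrier M \<and> y \<oplus> \<ominus> x \<in> U"
  then have "y = x \<oplus> (y \<oplus> \<ominus> x)" using x by simp
  then show "y \<in> coset M U x" using y unfolding coset_def by blast
qed

lemma coset_subset_carrier: "submodule M U \<Longrightarrow> x \<in> carrier M \<Longrightarrow> coset M U x \<subseteq> carrier M"
  using mem_coset_iff by blast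

lemma self_mem_coset: "submodule M U \<Longrightarrow> x \<in> carrier M \<Longrightarrow> x \<in> coset M U x"
  by (simp add: mem_coset_iff submodule_zero_mem)

lemma coset_eq_iff:
  assumes U: "submodule M U" and x: "x \<in> carrier M" and y: "y \<in> carrier M"
  shows "coset M U x = coset M U y \<longleftrightarrow> x \<oplus> \<ominus> y \<in> U"
proof
  assume "coset M U x = coset M U y"
  then show "x \<oplus> \<ominus> y \<in> U" using self_mem_coset[OF U x] mem_coset_iff[OF U y] by simp
next
  have subset: "coset M U p \<subseteq> coset M U q"
    if "p \<in> carrier M" "q \<in> carrier M" "p \<oplus> \<ominus> q \<in> U" for p q
  proof
    fix z assume "z \<in> coset M U p"
    then have z: "z \<in> carrier M" "z \<oplus> \<ominus> p \<in> U" using mem_coset_iff[OF U that(1)] by simp_all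
    have "z \<oplus> \<ominus> q = (z \<oplus> \<ominus> p) \<oplus> (p \<oplus> \<ominus> q)" using z(1) that by (simp add: add_assoc)
    also have "\<dots> \<in> U" using U z(2) that(3) by (rule submodule_add_mem)
    finally show "z \<in> coset M U q" using mem_coset_iff[OF U that(2)] z(1) by simp
  qed
  assume diff: "x \<oplus> \<ominus> y \<in> U"
  have "y \<oplus> \<ominus> x = \<ominus> (x \<oplus> \<ominus> y)" using x y by (simp add: neg_add_distrib add_commute)
  then have "y \<oplus> \<ominus> x \<in> U" using submodule_neg_mem[OF U diff] by simp
  then show "coset M U x = coset M U y" using subset x y diff by (intro subset_antisym)
qed

lemma coset_eq_of_mem:
  "submodule M U \<Longrightarrow> x \<in> carrier M \<Longrightarrow> y \<in> coset M U x \<Longrightarrow> coset M U y = coset M U x"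
  using mem_coset_iff coset_eq_iff by blast

lemma coset_zero [simp]: "submodule M U \<Longrightarrow> coset M U \<zero> = U"
  using submodule_carrier_mem by (force simp: coset_def)

lemma coset_eq_self_iff: "submodule M U \<Longrightarrow> x \<in> carrier M \<Longrightarrow> coset M U x = U \<longleftrightarrow> x \<in> U"
  using coset_eq_iff[of U x \<zero>] by simp

lemma coset_image_sumset_subset:
  assumes U: "submodule M U" and S: "S \<subseteq> U" and T: "T \<subseteq> carrier M"
  shows "coset M U ` (S \<^bold>+ T) \<subseteq> coset M U ` T"
proof
  fix A assume "A \<in> coset M U ` (S \<^bold>+ T)"
  then obtain x y where A: "A = coset M U (x \<oplus> y)" and x: "x \<in> S" and y: "y \<in> T"
    by (auto elim: sumsetE)
  have "x \<in> U" "x \<in> carrier M" "y \<in> carrier M" using x y S T submodule_carrier_mem[OF U] by blast+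
  then have "A = coset M U y" unfolding A by (simp add: coset_eq_iff[OF U] add_assoc)
  then show "A \<in> coset M U ` T" using y by blast
qed

lemma finite_coset_image_supset:
  assumes U: "submodule M U" and V: "submodule M V" "U \<subseteq> V" and T: "T \<subseteq> carrier M"
    and fin: "finite (coset M U ` T)"
  shows "finite (coset M V ` T)"
proof -
  have "coset M V x \<in> (\<lambda>A. \<Union>(coset M V ` A)) ` coset M U ` T" if "x \<in> T" for x
  proof -
    have x: "x \<in> carrier M" using that T by blast
    have "coset M V y = coset M V x" if "y \<in> coset M U x" for y
      using that V by (intro coset_eq_of_mem x) (auto simp: coset_def)
    then have "\<Union>(coset M V ` coset M U x) = coset M V x" using self_mem_coset[OF U x] by blast
    then show ?thesis using that by (metis image_eqI)
  qed
  then show ?thesis using fin by (meson finite_imageI finite_subset image_subsetI)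
qed

lemma finite_coset_image_Int:
  assumes U: "submodule M U" and N: "submodule M N" and fin: "finite (coset M U ` N)"
  shows "finite (coset M (U \<inter> N) ` N)"
proof -
  have "coset M (U \<inter> N) x = coset M U x \<inter> N" if xN: "x \<in> N" for x
  proof -
    have x: "x \<in> carrier M" using N xN by (rule submodule_carrier_mem)
    have "y \<oplus> \<ominus> x \<in> N \<longleftrightarrow> y \<in> N" if y: "y \<in> carrier M" for y
    proof
      assume "y \<oplus> \<ominus> x \<in> N"
      from submodule_add_mem[OF N xN this] show "y \<in> N" using x y by simp
    next
      assume "y \<in> N"
      then show "y \<oplus> \<ominus> x \<in> N" using N xN by (simp add: submodule_mems)
    qed
    then show ?thesis
      using mem_coset_iff[OF U x] mem_coset_iff[OF submodule_Int[OF U N] x] submodule_subset[OF N]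
      by blast
  qed
  then have "coset M (U \<inter> N) ` N = (\<lambda>A. A \<inter> N) ` coset M U ` N" by (auto simp: image_image)
  then show ?thesis using fin by simp
qed

section \<open>Quotient modules\<close>

lemma carrier_quot [simp]: "carrier (quot M U) = coset M U ` carrier M"
  and zero_quot [simp]: "zero (quot M U) = U"
  by (simp_all add: quot_def)

lemma add_quot:
  assumes U: "submodule M U" and x: "x \<in> carrier M" and y: "y \<in> carrier M"
  shows "add (quot M U) (coset M U x) (coset M U y) = coset M U (x \<oplus> y)"
proof -
  have "coset M U x \<^bold>+ coset M U y = coset M U (x \<oplus> y)"
  proof
    show "coset M U x \<^bold>+ coset M U y \<subseteq> coset M U (x \<oplus> y)"
    proof
      fix z assume "z \<in> coset M U x \<^bold>+ coset M U y"
      then obtain u v where z: "z = (x \<oplus> u) \<oplus> (y \<oplus> v)" and uv: "u \<in> U" "v \<in> U"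
        by (auto simp: coset_def elim: sumsetE)
      have "z = (x \<oplus> y) \<oplus> (u \<oplus> v)"
        using z x y submodule_carrier_mem[OF U] uv by (simp add: add_ac)
      then show "z \<in> coset M U (x \<oplus> y)"
        using submodule_add_mem[OF U uv] by (auto simp: coset_def)
    qed
    show "coset M U (x \<oplus> y) \<subseteq> coset M U x \<^bold>+ coset M U y"
    proof
      fix z assume "z \<in> coset M U (x \<oplus> y)"
      then obtain u where u: "u \<in> U" "z = (x \<oplus> y) \<oplus> u" by (auto simp: coset_def)
      then have "z = x \<oplus> (y \<oplus> u)" using x y submodule_carrier_mem[OF U] by (simp add: add_assoc)
      moreover have "y \<oplus> u \<in> coset M U y" using u(1) by (auto simp: coset_def)
      ultimately show "z \<in> coset M U x \<^bold>+ coset M U y"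
        using self_mem_coset[OF U x] by (simp add: sumsetI)
    qed
  qed
  then show ?thesis by (simp add: quot_def sumset_def)
qed

lemma neg_quot:
  assumes U: "submodule M U" and x: "x \<in> carrier M"
  shows "neg (quot M U) (coset M U x) = coset M U (\<ominus> x)"
proof -
  have "u \<in> neg M ` U" if "u \<in> U" for u
    using that submodule_carrier_mem[OF U] submodule_neg_mem[OF U]
    by (intro image_eqI[of _ _ "\<ominus> u"]) simp_all
  then have "neg M ` U = U" using submodule_neg_mem[OF U] by blast
  moreover have "neg M ` coset M U x = add M (\<ominus> x) ` neg M ` U"
    using x submodule_carrier_mem[OF U] by (simp add: coset_def image_image neg_add_distrib)
  ultimately show ?thesis by (simp add: quot_def coset_def)
qed

lemma act_quot:
  assumes U: "submodule M U" and x: "x \<in> carrier M"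
  shows "act (quot M U) a (coset M U x) = coset M U (a \<cdot> x)"
proof -
  have "u \<in> act M a ` U" if "u \<in> U" for u
    using that submodule_carrier_mem[OF U] submodule_act_mem[OF U]
    by (intro image_eqI[of _ _ "- a \<cdot> u"]) simp_all
  then have "act M a ` U = U" using submodule_act_mem[OF U] by blast
  moreover have "act M a ` coset M U x = add M (a \<cdot> x) ` act M a ` U"
    using x submodule_carrier_mem[OF U] by (simp add: coset_def image_image act_add)
  ultimately show ?thesis by (simp add: quot_def coset_def)
qed

lemma abgroup_action_quot:
  assumes U: "submodule M U"
  shows "abgroup_action (quot M U)"
proof
  note [simp] = add_quot[OF U] neg_quot[OF U] act_quot[OF U]
  note zero_coset = coset_zero[OF U, symmetric]
  show "zero (quot M U) \<in> carrier (quot M U)"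
    unfolding zero_quot carrier_quot using zero_closed by (subst zero_coset) (rule imageI)
  fix c d e a b
  assume "c \<in> carrier (quot M U)"
  then obtain x where x: "x \<in> carrier M" "c = coset M U x" by auto
  show "neg (quot M U) c \<in> carrier (quot M U)" "act (quot M U) a c \<in> carrier (quot M U)"
    "act (quot M U) 0 c = c"
    using x by simp_all
  show "act (quot M U) (a + b) c = act (quot M U) a (act (quot M U) b c)"
    using x by (simp add: act_act)
  show "add (quot M U) (zero (quot M U)) c = c"
    unfolding zero_quot by (subst zero_coset) (use x in simp)
  show "add (quot M U) (neg (quot M U) c) c = zero (quot M U)" using x U by simp
  assume "d \<in> carrier (quot M U)"
  then obtain y where y: "y \<in> carrier M" "d = coset M U y" by auto
  show "add (quot M U) c d \<in> carrier (quot M U)" using x y by simp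
  show "add (quot M U) c d = add (quot M U) d c" using x y by (simp add: add_commute)
  show "act (quot M U) a (add (quot M U) c d)
      = add (quot M U) (act (quot M U) a c) (act (quot M U) a d)"
    using x y by (simp add: act_add)
  assume "e \<in> carrier (quot M U)"
  then obtain z where z: "z \<in> carrier M" "e = coset M U z" by auto
  show "add (quot M U) (add (quot M U) c d) e = add (quot M U) c (add (quot M U) d e)"
    using x y z by (simp add: add_assoc)
qed

lemma submodule_quot_image:
  assumes U: "submodule M U" and T: "submodule M T"
  shows "submodule (quot M U) (coset M U ` T)"
  unfolding submodule_def
proof (intro conjI ballI allI)
  note T_carrier = submodule_carrier_mem[OF T]
  show "coset M U ` T \<subseteq> carrier (quot M U)" using T_carrier by auto
  show "zero (quot M U) \<in> coset M U ` T"
    using imageI[OF submodule_zero_mem[OF T], of "coset M U"] U by simp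
  fix c a assume "c \<in> coset M U ` T"
  then obtain x where x: "x \<in> T" "c = coset M U x" by blast
  show "neg (quot M U) c \<in> coset M U ` T" "act (quot M U) a c \<in> coset M U ` T"
    using x T_carrier T by (simp_all add: neg_quot[OF U] act_quot[OF U] submodule_mems)
  fix d assume "d \<in> coset M U ` T"
  then obtain y where y: "y \<in> T" "d = coset M U y" by blast
  show "add (quot M U) c d \<in> coset M U ` T"
    using x y T_carrier T by (simp add: add_quot[OF U] submodule_add_mem)
qed

lemma Union_coset_image: "\<Union>(coset M U ` S) = S \<^bold>+ U"
  by (simp add: coset_def sumset_eq_UN_translates)

lemma Union_coset_image_submodule:
  assumes U: "submodule M U" and T: "submodule M T" "U \<subseteq> T"
  shows "\<Union>(coset M U ` T) = T"
  unfolding Union_coset_image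
  using sumset_least[OF T(1) subset_refl T(2)]
    sumset_upper1[OF submodule_subset[OF T(1)] submodule_zero_mem[OF U]]
  by (rule subset_antisym)

lemma Union_cosets_eq:
  assumes U: "submodule M U" and S: "S \<subseteq> carrier (quot M U)"
  shows "\<Union>S = {x \<in> carrier M. coset M U x \<in> S}"
proof
  show "\<Union>S \<subseteq> {x \<in> carrier M. coset M U x \<in> S}"
  proof
    fix x assume "x \<in> \<Union>S"
    then obtain A where A: "A \<in> S" "x \<in> A" by blast
    then obtain y where y: "y \<in> carrier M" "A = coset M U y" using S by auto
    then have "coset M U x = A" "x \<in> carrier M"
      using A(2) coset_eq_of_mem[OF U] coset_subset_carrier[OF U] by blast+
    then show "x \<in> {x \<in> carrier M. coset M U x \<in> S}" using A(1) by simp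
  qed
  show "{x \<in> carrier M. coset M U x \<in> S} \<subseteq> \<Union>S" using self_mem_coset[OF U] by blast
qed

lemma coset_image_Union: "submodule M U \<Longrightarrow> S \<subseteq> carrier (quot M U) \<Longrightarrow> coset M U ` \<Union>S = S"
  using Union_cosets_eq[of U S] by auto

lemma submodule_Union_cosets:
  assumes U: "submodule M U" and S: "submodule (quot M U) S"
  shows "submodule M (\<Union>S)"
  unfolding submodule_def
proof (intro conjI ballI allI)
  have mem: "x \<in> \<Union>S \<longleftrightarrow> x \<in> carrier M \<and> coset M U x \<in> S" for x
    using Union_cosets_eq[OF U submodule_subset[OF S]] by simp
  show "\<Union>S \<subseteq> carrier M" using mem by blast
  show "\<zero> \<in> \<Union>S" using submodule_zero_mem[OF S] U unfolding mem by simp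
  fix x a assume x: "x \<in> \<Union>S"
  show "\<ominus> x \<in> \<Union>S"
    using x submodule_neg_mem[OF S] unfolding mem by (simp add: neg_quot[OF U, symmetric])
  show "a \<cdot> x \<in> \<Union>S"
    using x submodule_act_mem[OF S] unfolding mem by (simp add: act_quot[OF U, symmetric])
  fix y assume "y \<in> \<Union>S"
  then show "x \<oplus> y \<in> \<Union>S"
    using x submodule_add_mem[OF S] unfolding mem by (simp add: add_quot[OF U, symmetric])
qed

lemma subset_Union_cosets: "submodule (quot M U) S \<Longrightarrow> U \<subseteq> \<Union>S"
  using submodule_zero_mem by fastforce

lemma coset_quot:
  assumes U: "submodule M U" and S: "submodule (quot M U) S" and x: "x \<in> carrier M"
  shows "coset (quot M U) S (coset M U x) = coset M U ` coset M (\<Union>S) x"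
proof -
  have "coset (quot M U) S (coset M U x) = add (quot M U) (coset M U x) ` coset M U ` \<Union>S"
    unfolding coset_image_Union[OF U submodule_subset[OF S]] by (simp add: coset_def)
  also have "\<dots> = (\<lambda>y. coset M U (x \<oplus> y)) ` \<Union>S"
    unfolding image_image using x submodule_carrier_mem[OF submodule_Union_cosets[OF U S]]
    by (intro image_cong refl add_quot[OF U]) auto
  also have "\<dots> = coset M U ` coset M (\<Union>S) x" by (simp add: coset_def image_image)
  finally show ?thesis .
qed

lemma finite_coset_quot_image:
  assumes U: "submodule M U" and S: "submodule (quot M U) S" and T: "T \<subseteq> carrier M"
    and fin: "finite (coset M (\<Union>S) ` T)"
  shows "finite (coset (quot M U) S ` coset M U ` T)"
proof -
  have "coset (quot M U) S ` coset M U ` T = image (coset M U) ` coset M (\<Union>S) ` T"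
    unfolding image_image using T by (intro image_cong refl coset_quot[OF U S]) auto
  then show ?thesis using fin by simp
qed

end

section \<open>Topological modules\<close>

locale topological_module = abgroup_action M
  for M :: "('a, 'b::{topological_ab_group_add, t2_space}) lcmod" +
  assumes topspace_eq [simp]: "topspace (top M) = carrier M"
    and continuous_map_add:
      "continuous_map (prod_topology (top M) (top M)) (top M) (\<lambda>(x, y). add M x y)"
    and continuous_map_neg: "continuous_map (top M) (top M) (neg M)"
    and continuous_map_act:
      "continuous_map (prod_topology euclidean (top M)) (top M) (\<lambda>(a, x). act M a x)"
    and Hausdorff: "Hausdorff_space (top M)"
begin

lemma openin_carrier [simp]: "openin (top M) (carrier M)"
  using openin_topspace[of "top M"] by simp

lemma openin_subset_carrier: "openin (top M) P \<Longrightarrow> P \<subseteq> carrier M"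
  using openin_subset by fastforce

lemma compactin_subset_carrier: "compactin (top M) S \<Longrightarrow> S \<subseteq> carrier M"
  using compactin_subset_topspace by fastforce

lemma continuous_map_translate:
  assumes "x \<in> carrier M"
  shows "continuous_map (top M) (top M) (add M x)"
proof -
  have "continuous_map (top M) (prod_topology (top M) (top M)) (\<lambda>y. (x, y))"
    using assms by (intro continuous_map_pairedI) simp_all
  from continuous_map_compose[OF this continuous_map_add] show ?thesis by (simp add: o_def)
qed

lemma homeomorphic_map_translate:
  assumes "x \<in> carrier M"
  shows "homeomorphic_map (top M) (top M) (add M x)"
proof (rule homeomorphic_maps_imp_map)
  show "homeomorphic_maps (top M) (top M) (add M x) (add M (\<ominus> x))"
    using assms by (simp add: homeomorphic_maps_def continuous_map_translate)
qed

lemma continuous_map_act_right: "continuous_map (top M) (top M) (act M a)"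
proof -
  have "continuous_map (top M) (prod_topology euclidean (top M)) (\<lambda>y. (a, y))"
    by (intro continuous_map_pairedI) simp_all
  from continuous_map_compose[OF this continuous_map_act] show ?thesis by (simp add: o_def)
qed

lemma continuous_map_diff:
  "continuous_map (prod_topology (top M) (top M)) (top M) (\<lambda>(x, y). x \<oplus> \<ominus> y)"
proof -
  have "continuous_map (prod_topology (top M) (top M)) (prod_topology (top M) (top M))
      (\<lambda>(x, y). (x, \<ominus> y))"
    using continuous_map_neg by (simp add: continuous_map_prod_top)
  from continuous_map_compose[OF this continuous_map_add] show ?thesis
    by (simp add: o_def case_prod_unfold)
qed

lemma openin_translate: "x \<in> carrier M \<Longrightarrow> openin (top M) P \<Longrightarrow> openin (top M) (add M x ` P)"
  using homeomorphic_imp_open_map[OF homeomorphic_map_translate] by (simp add: open_map_def)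

lemma openin_coset: "x \<in> carrier M \<Longrightarrow> openin (top M) U \<Longrightarrow> openin (top M) (coset M U x)"
  unfolding coset_def by (rule openin_translate)

lemma openin_sumset:
  "S \<subseteq> carrier M \<Longrightarrow> openin (top M) P \<Longrightarrow> openin (top M) (S \<^bold>+ P)"
  unfolding sumset_eq_UN_translates by (intro openin_Union) (auto intro: openin_translate)

lemma openin_submoduleI:
  assumes S: "submodule M S" and P: "openin (top M) P" "\<zero> \<in> P" "P \<subseteq> S"
  shows "openin (top M) S"
proof -
  have "S \<^bold>+ P = S"
    using sumset_least[OF S subset_refl P(3)] sumset_upper1[OF submodule_subset[OF S] P(2)]
    by (rule subset_antisym)
  then show ?thesis using openin_sumset[OF submodule_subset[OF S] P(1)] by simp
qed

lemma closedin_open_submodule: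
  assumes U: "submodule M U" "openin (top M) U"
  shows "closedin (top M) U"
proof -
  have "(carrier M - U) \<^bold>+ U = carrier M - U"
  proof
    show "(carrier M - U) \<^bold>+ U \<subseteq> carrier M - U"
    proof
      fix z assume "z \<in> (carrier M - U) \<^bold>+ U"
      then obtain x u where z: "z = x \<oplus> u" and x: "x \<in> carrier M" "x \<notin> U" and u: "u \<in> U"
        by (auto elim: sumsetE)
      have u_carrier: "u \<in> carrier M" using U(1) u by (rule submodule_carrier_mem)
      have "x = z \<oplus> \<ominus> u" using z x(1) u_carrier by (simp add: add_ac)
      then have "z \<notin> U" using x(2) U(1) u by (auto simp: submodule_mems)
      then show "z \<in> carrier M - U" using z x(1) u_carrier by simp
    qed
  qed (intro sumset_upper1 submodule_zero_mem U(1), blast)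
  then have "openin (top M) (carrier M - U)"
    using openin_sumset[of "carrier M - U" U] U(2) by simp
  then show ?thesis using submodule_subset[OF U(1)] by (simp add: closedin_def)
qed

lemma compactin_sumset:
  assumes "compactin (top M) S" "compactin (top M) T"
  shows "compactin (top M) (S \<^bold>+ T)"
proof -
  have "compactin (prod_topology (top M) (top M)) (S \<times> T)"
    using assms by (simp add: compactin_Times)
  from image_compactin[OF this continuous_map_add]
  have "compactin (top M) ((\<lambda>(x, y). x \<oplus> y) ` (S \<times> T))" .
  moreover have "(\<lambda>(x, y). x \<oplus> y) ` (S \<times> T) = S \<^bold>+ T"
    unfolding sumset_def by force
  ultimately show ?thesis by simp
qed

lemma closedin_sumset:
  assumes F: "closedin (top M) F" and K: "compactin (top M) K"
  shows "closedin (top M) (F \<^bold>+ K)"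
proof -
  let ?X = "prod_topology (top M) (subtopology (top M) K)"
  let ?D = "{z \<in> topspace ?X. (\<lambda>(x, y). x \<oplus> \<ominus> y) z \<in> F}"
  have K_carrier: "K \<subseteq> carrier M" using K by (rule compactin_subset_carrier)
  have F_carrier: "F \<subseteq> carrier M" using closedin_subset[OF F] by simp
  have "?X = subtopology (prod_topology (top M) (top M)) (carrier M \<times> K)"
    by (simp add: prod_topology_subtopology)
  then have "continuous_map ?X (top M) (\<lambda>(x, y). x \<oplus> \<ominus> y)"
    using continuous_map_diff by (simp add: continuous_map_from_subtopology)
  then have "closedin ?X ?D" using F by (rule closedin_continuous_map_preimage)
  moreover have "closed_map ?X (top M) fst"
    using K by (intro closed_map_fst) (simp add: compact_space_subtopology)
  ultimately have "closedin (top M) (fst ` ?D)" by (simp add: closed_map_def)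
  moreover have "fst ` ?D = F \<^bold>+ K"
  proof
    show "fst ` ?D \<subseteq> F \<^bold>+ K"
    proof clarsimp
      fix x y assume "x \<in> carrier M" "y \<in> carrier M" "y \<in> K" "x \<oplus> \<ominus> y \<in> F"
      then have "x = (x \<oplus> \<ominus> y) \<oplus> y" by (simp add: add_assoc)
      then show "x \<in> F \<^bold>+ K" using sumsetI \<open>x \<oplus> \<ominus> y \<in> F\<close> \<open>y \<in> K\<close> by metis
    qed
    show "F \<^bold>+ K \<subseteq> fst ` ?D"
    proof
      fix z assume "z \<in> F \<^bold>+ K"
      then obtain x y where z: "z = x \<oplus> y" "x \<in> F" "y \<in> K" by (rule sumsetE)
      then have "x \<in> carrier M" "y \<in> carrier M" using F_carrier K_carrier by blast+
      then have "(z, y) \<in> ?D" using z by (simp add: add_assoc)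
      from imageI[OF this, of fst] show "z \<in> fst ` ?D" by (simp only: fst_conv)
    qed
  qed
  ultimately show ?thesis by simp
qed

lemma closure_of_subset_sumset:
  assumes S: "S \<subseteq> carrier M" and P: "openin (top M) P" "\<zero> \<in> P"
  shows "top M closure_of S \<subseteq> S \<^bold>+ P"
proof
  fix x assume x: "x \<in> top M closure_of S"
  then have x_carrier: "x \<in> carrier M" by (simp add: in_closure_of)
  let ?B = "{y \<in> topspace (top M). x \<oplus> \<ominus> y \<in> P}"
  have "continuous_map (top M) (top M) (\<lambda>y. x \<oplus> \<ominus> y)"
    using continuous_map_compose[OF continuous_map_neg continuous_map_translate[OF x_carrier]]
    by (simp add: o_def)
  then have "openin (top M) ?B" using P(1) by (rule openin_continuous_map_preimage)
  moreover have "x \<in> ?B" using x_carrier P(2) by simp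
  ultimately obtain y where y: "y \<in> S" "y \<in> ?B" using x unfolding in_closure_of by meson
  then have "x = y \<oplus> (x \<oplus> \<ominus> y)" using x_carrier by simp
  then show "x \<in> S \<^bold>+ P" using y sumsetI[of y S "x \<oplus> \<ominus> y" P] by simp
qed

lemma submodule_subset_closure_of: "submodule M S \<Longrightarrow> S \<subseteq> top M closure_of S"
  by (simp add: closure_of_subset submodule_subset)

lemma submodule_closure_of:
  assumes S: "submodule M S"
  shows "submodule M (top M closure_of S)" (is "submodule M ?cl")
  unfolding submodule_def
proof (intro conjI ballI allI)
  have maps: "f x \<in> ?cl"
    if "continuous_map (top M) (top M) f" "f ` S \<subseteq> S" "x \<in> ?cl" for f x
    using continuous_map_image_closure_subset[OF that(1), of S] closure_of_mono[OF that(2)] that(3)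
    by blast
  show "?cl \<subseteq> carrier M" using closure_of_subset_topspace[of "top M" S] by simp
  show "\<zero> \<in> ?cl"
    using submodule_subset_closure_of[OF S] submodule_zero_mem[OF S] by blast
  fix x a assume x: "x \<in> ?cl"
  show "\<ominus> x \<in> ?cl"
    by (rule maps[OF continuous_map_neg _ x]) (use submodule_neg_mem[OF S] in blast)
  show "a \<cdot> x \<in> ?cl"
    by (rule maps[OF continuous_map_act_right _ x]) (use submodule_act_mem[OF S] in blast)
  fix y assume y: "y \<in> ?cl"
  have "(x, y) \<in> prod_topology (top M) (top M) closure_of (S \<times> S)"
    using x y by (simp add: closure_of_Times)
  from subsetD[OF continuous_map_image_closure_subset[OF continuous_map_add] imageI[OF this]]
  have "x \<oplus> y \<in> top M closure_of ((\<lambda>(x, y). x \<oplus> y) ` (S \<times> S))" by simp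
  moreover have "(\<lambda>(x, y). x \<oplus> y) ` (S \<times> S) \<subseteq> S"
    using submodule_add_mem[OF S] by auto
  ultimately show "x \<oplus> y \<in> ?cl" using closure_of_mono subsetD by metis
qed

lemma finite_coset_image_compactin:
  assumes V: "compactin (top M) V" and U: "submodule M U" and Q: "openin (top M) Q" "\<zero> \<in> Q"
    and small: "\<And>x y. x \<in> V \<Longrightarrow> y \<in> V \<Longrightarrow> y \<oplus> \<ominus> x \<in> Q \<Longrightarrow> y \<oplus> \<ominus> x \<in> U"
  shows "finite (coset M U ` V)"
proof -
  have V_carrier: "V \<subseteq> carrier M" using V by (rule compactin_subset_carrier)
  have "openin (top M) B" if "B \<in> (\<lambda>x. add M x ` Q) ` V" for B
    using that V_carrier Q(1) by (auto intro: openin_translate)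
  moreover have "V \<subseteq> \<Union>((\<lambda>x. add M x ` Q) ` V)"
  proof
    fix x assume x: "x \<in> V"
    then have "x = x \<oplus> \<zero>" using V_carrier by auto
    then show "x \<in> \<Union>((\<lambda>x. add M x ` Q) ` V)" using x Q(2) by blast
  qed
  ultimately obtain \<F> where \<F>: "finite \<F>" "\<F> \<subseteq> (\<lambda>x. add M x ` Q) ` V" "V \<subseteq> \<Union>\<F>"
    using compactinD[OF V] by meson
  from finite_subset_image[OF \<F>(1,2)] obtain F
    where F: "F \<subseteq> V" "finite F" "\<F> = (\<lambda>x. add M x ` Q) ` F" by blast
  have "coset M U ` V \<subseteq> coset M U ` F"
  proof
    fix A assume "A \<in> coset M U ` V"
    then obtain y where y: "y \<in> V" "A = coset M U y" by blast
    then obtain x q where x: "x \<in> F" and q: "q \<in> Q" "y = x \<oplus> q" using \<F>(3) F(3) by blast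
    have mem_carrier: "x \<in> carrier M" "y \<in> carrier M" "q \<in> carrier M"
      using x y q V_carrier F(1) openin_subset_carrier[OF Q(1)] by blast+
    have "y \<oplus> \<ominus> x = q" using q(2) mem_carrier by (simp add: add_assoc)
    then have "y \<oplus> \<ominus> x \<in> U" using small x y q(1) F(1) by blast
    then have "A = coset M U x" using y(2) coset_eq_iff[OF U] mem_carrier by simp
    then show "A \<in> coset M U ` F" using x by blast
  qed
  then show ?thesis using F(2) by (meson finite_imageI finite_subset)
qed

lemma ex_small_nbhd_zero:
  assumes Q: "openin (top M) Q" "\<zero> \<in> Q" and K: "compact K"
  obtains P where "openin (top M) P" "\<zero> \<in> P"
    "\<And>x y. x \<in> P \<Longrightarrow> y \<in> P \<Longrightarrow> x \<oplus> y \<in> Q" "\<And>x. x \<in> P \<Longrightarrow> \<ominus> x \<in> Q"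
    "\<And>a x. a \<in> K \<Longrightarrow> x \<in> P \<Longrightarrow> a \<cdot> x \<in> Q"
proof -
  have compact_zero: "compactin (top M) {\<zero>}" and zero_top: "\<zero> \<in> topspace (top M)" by simp_all
  obtain P\<^sub>1 P\<^sub>2 where add_nbhds: "openin (top M) P\<^sub>1" "openin (top M) P\<^sub>2" "{\<zero>} \<subseteq> P\<^sub>1" "\<zero> \<in> P\<^sub>2"
    "\<And>x y. x \<in> P\<^sub>1 \<Longrightarrow> y \<in> P\<^sub>2 \<Longrightarrow> (\<lambda>(x, y). x \<oplus> y) (x, y) \<in> Q"
    by (rule continuous_map_prod_compact_nbhd[OF continuous_map_add Q(1) compact_zero zero_top])
      (use Q(2) in auto)
  have compact_K: "compactin euclidean K" using K by simp
  obtain A P\<^sub>3 where act_nbhds: "open A" "openin (top M) P\<^sub>3" "K \<subseteq> A" "\<zero> \<in> P\<^sub>3"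
    "\<And>a x. a \<in> A \<Longrightarrow> x \<in> P\<^sub>3 \<Longrightarrow> (\<lambda>(a, x). a \<cdot> x) (a, x) \<in> Q"
    by (rule continuous_map_prod_compact_nbhd[OF continuous_map_act Q(1) compact_K zero_top])
      (use Q(2) in auto)
  let ?P\<^sub>4 = "{x \<in> topspace (top M). \<ominus> x \<in> Q}"
  have neg_nbhd: "openin (top M) ?P\<^sub>4"
    using continuous_map_neg Q(1) by (rule openin_continuous_map_preimage)
  show ?thesis
  proof (rule that[of "P\<^sub>1 \<inter> P\<^sub>2 \<inter> P\<^sub>3 \<inter> ?P\<^sub>4"])
    show "openin (top M) (P\<^sub>1 \<inter> P\<^sub>2 \<inter> P\<^sub>3 \<inter> ?P\<^sub>4)"
      using add_nbhds(1,2) act_nbhds(2) neg_nbhd by blast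
  qed (use add_nbhds(3-5) act_nbhds(3-5) Q(2) in auto)
qed

lemma topological_module_submod:
  assumes N: "submodule M N"
  shows "topological_module (submod M N)"
proof (intro topological_module.intro topological_module_axioms.intro)
  show "abgroup_action (submod M N)" using N by (rule abgroup_action_submod)
  show "topspace (top (submod M N)) = carrier (submod M N)"
    using submodule_subset[OF N] by (simp add: Int_absorb1)
  have "prod_topology (subtopology (top M) N) (subtopology (top M) N)
      = subtopology (prod_topology (top M) (top M)) (N \<times> N)"
    by (simp add: subtopology_Times)
  then show "continuous_map (prod_topology (top (submod M N)) (top (submod M N))) (top (submod M N))
      (\<lambda>(x, y). add (submod M N) x y)"
    using continuous_map_from_subtopology[OF continuous_map_add, of "N \<times> N"] submodule_add_mem[OF N]
    by (auto simp: continuous_map_in_subtopology)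
  show "continuous_map (top (submod M N)) (top (submod M N)) (neg (submod M N))"
    using continuous_map_from_subtopology[OF continuous_map_neg, of N] submodule_neg_mem[OF N]
    by (auto simp: continuous_map_in_subtopology)
  have "prod_topology (euclidean :: 'b topology) (subtopology (top M) N)
      = subtopology (prod_topology euclidean (top M)) (UNIV \<times> N)"
    by (simp add: subtopology_Times)
  then show "continuous_map (prod_topology euclidean (top (submod M N))) (top (submod M N))
      (\<lambda>(a, x). act (submod M N) a x)"
    using continuous_map_from_subtopology[OF continuous_map_act, of "UNIV \<times> N"]
      submodule_act_mem[OF N]
    by (auto simp: continuous_map_in_subtopology)
  show "Hausdorff_space (top (submod M N))"
    using Hausdorff by (simp add: Hausdorff_space_subtopology)
qed

section \<open>The quotient topology\<close>

lemma openin_quot_iff: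
  assumes U: "submodule M U"
  shows "openin (top (quot M U)) S \<longleftrightarrow> S \<subseteq> carrier (quot M U) \<and> openin (top M) (\<Union>S)"
proof -
  let ?opn = "\<lambda>S. S \<subseteq> carrier (quot M U) \<and> openin (top M) (\<Union>S)"
  have "istopology ?opn"
    unfolding istopology_def
  proof (intro conjI allI impI)
    fix S T assume S: "?opn S" and T: "?opn T"
    show "S \<inter> T \<subseteq> carrier (quot M U)" using S by blast
    then have "\<Union>(S \<inter> T) = \<Union>S \<inter> \<Union>T"
      using S T by (auto simp: Union_cosets_eq[OF U] simp del: carrier_quot)
    then show "openin (top M) (\<Union>(S \<inter> T))" using S T by auto
  next
    fix \<K> assume \<K>: "\<forall>K\<in>\<K>. ?opn K"
    then show "\<Union>\<K> \<subseteq> carrier (quot M U)" by blast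
    have "\<Union>(\<Union>\<K>) = (\<Union>K\<in>\<K>. \<Union>K)" by blast
    then show "openin (top M) (\<Union>(\<Union>\<K>))" using \<K> by auto
  qed
  moreover have "top (quot M U) = topology ?opn" by (simp add: quot_def)
  ultimately show ?thesis by simp
qed

lemma topspace_quot:
  assumes U: "submodule M U"
  shows "topspace (top (quot M U)) = carrier (quot M U)"
proof
  show "topspace (top (quot M U)) \<subseteq> carrier (quot M U)"
    using openin_topspace[of "top (quot M U)"] unfolding openin_quot_iff[OF U] by blast
  have "\<Union>(carrier (quot M U)) = carrier M"
    using Union_coset_image_submodule[OF U submodule_carrier submodule_subset[OF U]] by simp
  then have "openin (top (quot M U)) (carrier (quot M U))"
    unfolding openin_quot_iff[OF U] by simp
  then show "carrier (quot M U) \<subseteq> topspace (top (quot M U))" by (rule openin_subset)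
qed

lemma quotient_map_coset:
  assumes U: "submodule M U"
  shows "quotient_map (top M) (top (quot M U)) (coset M U)"
  unfolding quotient_map_def topspace_quot[OF U]
proof (intro conjI allI impI)
  fix S assume S: "S \<subseteq> carrier (quot M U)"
  then show "openin (top M) {x \<in> topspace (top M). coset M U x \<in> S} \<longleftrightarrow> openin (top (quot M U)) S"
    unfolding openin_quot_iff[OF U] Union_cosets_eq[OF U S] by simp
qed simp

lemma open_map_coset:
  assumes U: "submodule M U"
  shows "open_map (top M) (top (quot M U)) (coset M U)"
  unfolding open_map_def
proof (intro allI impI)
  fix P assume P: "openin (top M) P"
  have P_carrier: "P \<subseteq> carrier M" using P by (rule openin_subset_carrier)
  then have "openin (top M) (\<Union>(coset M U ` P))"
    unfolding Union_coset_image sumset_commute[OF P_carrier submodule_subset[OF U]]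
    using submodule_subset[OF U] P by (intro openin_sumset)
  then show "openin (top (quot M U)) (coset M U ` P)"
    using P_carrier unfolding openin_quot_iff[OF U] by auto
qed

lemma discrete_quot_iff:
  assumes U: "submodule M U"
  shows "top (quot M U) = discrete_topology (carrier (quot M U)) \<longleftrightarrow> openin (top M) U"
proof
  assume "top (quot M U) = discrete_topology (carrier (quot M U))"
  moreover have "U \<in> carrier (quot M U)"
    using imageI[OF zero_closed, of "coset M U"] U by simp
  ultimately have "openin (top (quot M U)) {U}" by simp
  then show "openin (top M) U" unfolding openin_quot_iff[OF U] by simp
next
  assume "openin (top M) U"
  then have "\<forall>A\<in>carrier (quot M U). openin (top (quot M U)) {A}"
    unfolding openin_quot_iff[OF U] by (auto intro: openin_coset)
  then show "top (quot M U) = discrete_topology (carrier (quot M U))"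
    using discrete_topology_unique topspace_quot[OF U] by metis
qed

lemma proper_map_coset:
  assumes W: "submodule M W" "compactin (top M) W"
  shows "proper_map (top M) (top (quot M W)) (coset M W)"
  unfolding proper_map_def
proof
  show "closed_map (top M) (top (quot M W)) (coset M W)"
    unfolding closed_map_def
  proof (intro allI impI)
    fix F assume F: "closedin (top M) F"
    have sub: "coset M W ` F \<subseteq> carrier (quot M W)" using closedin_subset[OF F] by auto
    have "{x \<in> topspace (top M). coset M W x \<in> coset M W ` F} = F \<^bold>+ W"
      using Union_cosets_eq[OF W(1) sub] by (simp add: Union_coset_image)
    then have "closedin (top M) {x \<in> topspace (top M). coset M W x \<in> coset M W ` F}"
      using closedin_sumset[OF F W(2)] by simp
    then show "closedin (top (quot M W)) (coset M W ` F)"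
      using quotient_map_coset[OF W(1)] sub
      unfolding quotient_map_closedin topspace_quot[OF W(1)] by blast
  qed
  show "\<forall>A\<in>topspace (top (quot M W)). compactin (top M) {x \<in> topspace (top M). coset M W x = A}"
  proof
    fix A assume "A \<in> topspace (top (quot M W))"
    then have A: "{A} \<subseteq> carrier (quot M W)" unfolding topspace_quot[OF W(1)] by simp
    then obtain x where x: "x \<in> carrier M" "A = coset M W x" by auto
    have "{x \<in> topspace (top M). coset M W x = A} = coset M W x"
      using Union_cosets_eq[OF W(1) A] x(2) by auto
    moreover have "compactin (top M) (coset M W x)"
      unfolding coset_def using W(2) continuous_map_translate[OF x(1)] by (rule image_compactin)
    ultimately show "compactin (top M) {x \<in> topspace (top M). coset M W x = A}" by simp
  qed
qed

lemma compactin_Union_cosets: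
  assumes W: "submodule M W" "compactin (top M) W" and S: "compactin (top (quot M W)) S"
  shows "compactin (top M) (\<Union>S)"
proof -
  have "S \<subseteq> carrier (quot M W)" using compactin_subset_topspace[OF S] topspace_quot[OF W(1)] by simp
  then show ?thesis
    using compactin_proper_map_preimage[OF proper_map_coset[OF W] S] Union_cosets_eq[OF W(1)]
    by simp
qed

lemma Hausdorff_space_quot:
  assumes U: "submodule M U" "closedin (top M) U"
  shows "Hausdorff_space (top (quot M U))"
proof -
  let ?X = "prod_topology (top M) (top M)"
  let ?Y = "prod_topology (top (quot M U)) (top (quot M U))"
  let ?\<pi> = "\<lambda>(x, y). (coset M U x, coset M U y)"
  let ?diagonal = "(\<lambda>A. (A, A)) ` topspace (top (quot M U))"
  have "quotient_map ?X ?Y ?\<pi>"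
    by (intro quotient_map_prod_open quotient_map_coset open_map_coset U(1))
  moreover have "?diagonal \<subseteq> topspace ?Y" by auto
  ultimately have "closedin ?Y ?diagonal \<longleftrightarrow> closedin ?X {z \<in> topspace ?X. ?\<pi> z \<in> ?diagonal}"
    unfolding quotient_map_closedin by blast
  moreover have "{z \<in> topspace ?X. ?\<pi> z \<in> ?diagonal} = {z \<in> topspace ?X. (\<lambda>(x, y). x \<oplus> \<ominus> y) z \<in> U}"
  proof (rule Collect_cong, rule conj_cong[OF refl])
    fix z assume "z \<in> topspace ?X"
    then obtain x y where z: "z = (x, y)" "x \<in> carrier M" "y \<in> carrier M" by auto
    have "?\<pi> z \<in> ?diagonal \<longleftrightarrow> coset M U x = coset M U y"
      unfolding topspace_quot[OF U(1)] using z by auto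
    then show "?\<pi> z \<in> ?diagonal \<longleftrightarrow> (\<lambda>(x, y). x \<oplus> \<ominus> y) z \<in> U"
      using z coset_eq_iff[OF U(1)] by simp
  qed
  moreover have "closedin ?X {z \<in> topspace ?X. (\<lambda>(x, y). x \<oplus> \<ominus> y) z \<in> U}"
    using continuous_map_diff U(2) by (rule closedin_continuous_map_preimage)
  ultimately show ?thesis unfolding Hausdorff_space_closedin_diagonal by simp
qed

lemma topological_module_quot:
  assumes U: "submodule M U" "closedin (top M) U"
  shows "topological_module (quot M U)"
proof (intro topological_module.intro topological_module_axioms.intro)
  note q_map = quotient_map_coset[OF U(1)] and q_open = open_map_coset[OF U(1)]
  note q_cont = quotient_imp_continuous_map[OF q_map]
  note q_q_map = quotient_map_prod_open[OF q_map q_open q_map q_open]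
  show "abgroup_action (quot M U)" using U(1) by (rule abgroup_action_quot)
  show "topspace (top (quot M U)) = carrier (quot M U)" using U(1) by (rule topspace_quot)
  show "Hausdorff_space (top (quot M U))" using U by (rule Hausdorff_space_quot)
  show "continuous_map (prod_topology (top (quot M U)) (top (quot M U))) (top (quot M U))
      (\<lambda>(c, d). add (quot M U) c d)"
  proof (rule continuous_compose_quotient_map[OF q_q_map])
    show "continuous_map (prod_topology (top M) (top M)) (top (quot M U))
        ((\<lambda>(c, d). add (quot M U) c d) \<circ> (\<lambda>(x, y). (coset M U x, coset M U y)))"
      by (rule continuous_map_eq[OF continuous_map_compose[OF continuous_map_add q_cont]])
        (auto simp: add_quot[OF U(1)])
  qed
  show "continuous_map (top (quot M U)) (top (quot M U)) (neg (quot M U))"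
  proof (rule continuous_compose_quotient_map[OF q_map])
    show "continuous_map (top M) (top (quot M U)) (neg (quot M U) \<circ> coset M U)"
      by (rule continuous_map_eq[OF continuous_map_compose[OF continuous_map_neg q_cont]])
        (simp add: neg_quot[OF U(1)])
  qed
  have id_q_map: "quotient_map (prod_topology euclidean (top M))
      (prod_topology euclidean (top (quot M U))) (\<lambda>(a :: 'b, x). (a, coset M U x))"
    by (intro quotient_map_prod_open[where f = "\<lambda>x. x"] q_map q_open)
      (simp_all add: quotient_map_def open_map_def)
  show "continuous_map (prod_topology euclidean (top (quot M U))) (top (quot M U))
      (\<lambda>(a, c). act (quot M U) a c)"
  proof (rule continuous_compose_quotient_map[OF id_q_map])
    show "continuous_map (prod_topology euclidean (top M)) (top (quot M U))
        ((\<lambda>(a, c). act (quot M U) a c) \<circ> (\<lambda>(a, x). (a, coset M U x)))"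
      by (rule continuous_map_eq[OF continuous_map_compose[OF continuous_map_act q_cont]])
        (auto simp: act_quot[OF U(1)])
  qed
qed

end

section \<open>Compact parafinite and codiscrete submodules\<close>

definition compact_parafinite_submodule :: "('a, 'b) lcmod \<Rightarrow> 'a set \<Rightarrow> bool" where
  "compact_parafinite_submodule M N \<longleftrightarrow> submodule M N \<and> compact_parafinite (submod M N)"

definition codiscrete_submodule :: "('a, 'b) lcmod \<Rightarrow> 'a set \<Rightarrow> bool" where
  "codiscrete_submodule M U \<longleftrightarrow> submodule M U \<and> openin (top M) U \<and> purely_discrete (quot M U)"

context topological_module
begin

lemma compact_parafinite_submod_iff:
  assumes N: "submodule M N"
  shows "compact_parafinite (submod M N) \<longleftrightarrow> compactin (top M) N \<and>
    (\<forall>U. submodule M U \<and> U \<subseteq> N \<and> closedin (top M) U \<and> finite (coset M U ` N) \<longrightarrow> U = N)"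
proof -
  have quot_carrier: "carrier (quot (submod M N) U) = coset M U ` N" for U
    by (simp add: quot_def)
  have compact: "compact_space (subtopology (top M) N) \<longleftrightarrow> compactin (top M) N"
    using submodule_subset[OF N] by (simp add: compactin_subspace)
  have closed: "closedin (subtopology (top M) N) U \<longleftrightarrow> closedin (top M) U"
    if "compactin (top M) N" "U \<subseteq> N" for U
    using closedin_trans_full[OF _ compactin_imp_closedin[OF Hausdorff that(1)]]
      closedin_subset_topspace[of "top M" U N] that(2) by blast
  show ?thesis
    unfolding compact_parafinite_def submodule_submod_iff[OF N] quot_carrier submod_simps compact
    using closed by blast
qed

lemma compact_parafinite_submodule_iff:
  "compact_parafinite_submodule M N \<longleftrightarrow> submodule M N \<and> compactin (top M) N \<and>
    (\<forall>U. submodule M U \<and> closedin (top M) U \<and> finite (coset M U ` N) \<longrightarrow> N \<subseteq> U)"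
proof -
  have "N \<subseteq> U"
    if N: "submodule M N" "compactin (top M) N"
      and parafinite:
        "\<forall>U. submodule M U \<and> U \<subseteq> N \<and> closedin (top M) U \<and> finite (coset M U ` N) \<longrightarrow> U = N"
      and U: "submodule M U" "closedin (top M) U" "finite (coset M U ` N)" for U
  proof -
    have "submodule M (U \<inter> N)" "closedin (top M) (U \<inter> N)" "finite (coset M (U \<inter> N) ` N)"
      using U N compactin_imp_closedin[OF Hausdorff N(2)]
      by (simp_all add: submodule_Int closedin_Int finite_coset_image_Int)
    then have "U \<inter> N = N" using parafinite by simp
    then show "N \<subseteq> U" by blast
  qed
  then show ?thesis
    unfolding compact_parafinite_submodule_def using compact_parafinite_submod_iff
    by (metis subset_antisym)
qed

lemma purely_discrete_quot_iff:
  assumes U: "submodule M U"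
  shows "purely_discrete (quot M U) \<longleftrightarrow> openin (top M) U \<and>
    (\<forall>T. submodule M T \<and> finite (coset M U ` T) \<longrightarrow> T \<subseteq> U)"
proof -
  have "T \<subseteq> U"
    if "\<forall>S. submodule (quot M U) S \<and> finite S \<longrightarrow> S = {U}"
      and T: "submodule M T" "finite (coset M U ` T)" for T
  proof -
    have "coset M U ` T = {U}" using that submodule_quot_image[OF U] by blast
    then show "T \<subseteq> U" using submodule_carrier_mem[OF T(1)] self_mem_coset[OF U] by blast
  qed
  moreover have "S = {U}"
    if pure: "\<forall>T. submodule M T \<and> finite (coset M U ` T) \<longrightarrow> T \<subseteq> U"
      and S: "submodule (quot M U) S" "finite S" for S
  proof -
    have S_eq: "coset M U ` \<Union>S = S" using U submodule_subset[OF S(1)] by (rule coset_image_Union)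
    then have "\<Union>S \<subseteq> U" using pure S submodule_Union_cosets[OF U] by simp
    then have "\<Union>S = U" using subset_Union_cosets[OF S(1)] by (rule subset_antisym)
    moreover have "coset M U ` U = {U}"
      using coset_eq_self_iff[OF U] submodule_carrier_mem[OF U] submodule_zero_mem[OF U] by auto
    ultimately show "S = {U}" using S_eq by simp
  qed
  ultimately have "(\<forall>S. submodule (quot M U) S \<and> finite S \<longrightarrow> S = {U}) \<longleftrightarrow>
      (\<forall>T. submodule M T \<and> finite (coset M U ` T) \<longrightarrow> T \<subseteq> U)" by blast
  then show ?thesis unfolding purely_discrete_def zero_quot discrete_quot_iff[OF U] by simp
qed

lemma codiscrete_submodule_iff:
  "codiscrete_submodule M U \<longleftrightarrow> submodule M U \<and> openin (top M) U \<and>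
    (\<forall>T. submodule M T \<and> finite (coset M U ` T) \<longrightarrow> T \<subseteq> U)"
  unfolding codiscrete_submodule_def using purely_discrete_quot_iff by blast

lemma compact_parafinite_submodule_subset:
  assumes "compact_parafinite_submodule M N" "submodule M U" "closedin (top M) U"
    and "finite (coset M U ` N)"
  shows "N \<subseteq> U"
  using assms unfolding compact_parafinite_submodule_iff by blast

lemma codiscrete_submodule_upper:
  assumes "codiscrete_submodule M U" "submodule M T" "finite (coset M U ` T)"
  shows "T \<subseteq> U"
  using assms unfolding codiscrete_submodule_iff by blast

lemma compact_parafinite_submodule_subset_nbhd:
  assumes N: "compact_parafinite_submodule M N" and U: "submodule M U" "closedin (top M) U"
    and Q: "openin (top M) Q" "\<zero> \<in> Q" "Q \<inter> N \<subseteq> U"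
  shows "N \<subseteq> U"
proof (rule compact_parafinite_submodule_subset[OF N U])
  have N_sub: "submodule M N" and N_compact: "compactin (top M) N"
    using N by (simp_all add: compact_parafinite_submodule_iff)
  show "finite (coset M U ` N)"
  proof (rule finite_coset_image_compactin[OF N_compact U(1) Q(1,2)])
    fix x y assume "x \<in> N" "y \<in> N" "y \<oplus> \<ominus> x \<in> Q"
    then show "y \<oplus> \<ominus> x \<in> U" using Q(3) N_sub by (auto simp: submodule_mems)
  qed
qed

lemma compact_parafinite_submodule_subset_codiscrete:
  assumes N: "compact_parafinite_submodule M N" and U: "codiscrete_submodule M U"
  shows "N \<subseteq> U"
proof -
  have "submodule M U" "openin (top M) U" using U by (simp_all add: codiscrete_submodule_def)
  then show ?thesis
    by (intro compact_parafinite_submodule_subset_nbhd[OF N, where Q = U] closedin_open_submodule)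
      (simp_all add: submodule_zero_mem)
qed

lemma compact_parafinite_submodule_hull:
  assumes "submodule M N" "compactin (top M) N"
    and parts: "\<And>L. L \<in> \<F> \<Longrightarrow> compact_parafinite_submodule M L \<and> L \<subseteq> N"
    and hull: "\<And>U. submodule M U \<Longrightarrow> closedin (top M) U \<Longrightarrow> \<Union>\<F> \<subseteq> U \<Longrightarrow> N \<subseteq> U"
  shows "compact_parafinite_submodule M N"
  unfolding compact_parafinite_submodule_iff
proof (intro conjI allI impI assms(1,2))
  fix U assume U: "submodule M U \<and> closedin (top M) U \<and> finite (coset M U ` N)"
  have "L \<subseteq> U" if "L \<in> \<F>" for L
  proof -
    have "finite (coset M U ` L)" using U parts[OF that] by (meson finite_subset image_mono)
    then show ?thesis using U parts[OF that] by (intro compact_parafinite_submodule_subset) simp_all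
  qed
  then show "N \<subseteq> U" using U by (intro hull) auto
qed

lemma compact_parafinite_submodule_zero: "compact_parafinite_submodule M {\<zero>}"
  by (rule compact_parafinite_submodule_hull[of _ "{}"]) (auto simp: submodule_zero_mem)

lemma compact_parafinite_submodule_sumset:
  assumes N: "compact_parafinite_submodule M N" and L: "compact_parafinite_submodule M L"
  shows "compact_parafinite_submodule M (N \<^bold>+ L)"
proof (rule compact_parafinite_submodule_hull[of _ "{N, L}"])
  have submodules: "submodule M N" "submodule M L" "compactin (top M) N" "compactin (top M) L"
    using N L by (simp_all add: compact_parafinite_submodule_iff)
  then show "submodule M (N \<^bold>+ L)" "compactin (top M) (N \<^bold>+ L)"
    by (simp_all add: submodule_sumset compactin_sumset)
  have "N \<union> L \<subseteq> N \<^bold>+ L" using submodules(1,2) by (rule Un_subset_sumset)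
  then show "\<And>K. K \<in> {N, L} \<Longrightarrow> compact_parafinite_submodule M K \<and> K \<subseteq> N \<^bold>+ L" using N L by auto
  show "\<And>U. submodule M U \<Longrightarrow> closedin (top M) U \<Longrightarrow> \<Union>{N, L} \<subseteq> U \<Longrightarrow> N \<^bold>+ L \<subseteq> U"
    by (simp add: sumset_least)
qed

lemma codiscrete_submodule_carrier: "codiscrete_submodule M (carrier M)"
  by (simp add: codiscrete_submodule_iff submodule_subset)

lemma codiscrete_submodule_Inter:
  assumes "\<F> \<noteq> {}" and codiscrete: "\<And>U. U \<in> \<F> \<Longrightarrow> codiscrete_submodule M U"
    and opn: "openin (top M) (\<Inter>\<F>)"
  shows "codiscrete_submodule M (\<Inter>\<F>)"
  unfolding codiscrete_submodule_iff
proof (intro conjI allI impI opn)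
  have sub: "submodule M U" if "U \<in> \<F>" for U
    using codiscrete[OF that] by (simp add: codiscrete_submodule_def)
  then show Inter: "submodule M (\<Inter>\<F>)" using assms(1) by (intro submodule_Inter)
  fix T assume T: "submodule M T \<and> finite (coset M (\<Inter>\<F>) ` T)"
  show "T \<subseteq> \<Inter>\<F>"
  proof (rule Inter_greatest)
    fix U assume U: "U \<in> \<F>"
    have "finite (coset M U ` T)"
      using T U
      by (intro finite_coset_image_supset[OF Inter sub[OF U]]) (auto simp: submodule_subset)
    then show "T \<subseteq> U" using codiscrete[OF U] T by (intro codiscrete_submodule_upper) simp_all
  qed
qed

lemma codiscrete_submodule_Int:
  assumes "codiscrete_submodule M U" "codiscrete_submodule M V"
  shows "codiscrete_submodule M (U \<inter> V)"
proof -
  have "openin (top M) (U \<inter> V)" using assms by (auto simp: codiscrete_submodule_def)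
  then show ?thesis using codiscrete_submodule_Inter[of "{U, V}"] assms by auto
qed

lemma compact_parafinite_submodule_submod_iff:
  "submodule M L \<Longrightarrow>
    compact_parafinite_submodule (submod M L) N \<longleftrightarrow> compact_parafinite_submodule M N \<and> N \<subseteq> L"
  by (auto simp: compact_parafinite_submodule_def submodule_submod_iff submod_submod)

lemma codiscrete_submodule_trans:
  assumes L: "codiscrete_submodule M L" and U: "codiscrete_submodule (submod M L) U"
  shows "codiscrete_submodule M U"
proof -
  have L_sub: "submodule M L" and L_open: "openin (top M) L"
    using L by (simp_all add: codiscrete_submodule_def)
  interpret L: topological_module "submod M L" using L_sub by (rule topological_module_submod)
  have U_sub: "submodule M U" and U_L: "U \<subseteq> L" and "openin (subtopology (top M) L) U"
    using U by (simp_all add: codiscrete_submodule_def submodule_submod_iff[OF L_sub])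
  then have U_open: "openin (top M) U" using L_open openin_trans_full by blast
  show ?thesis
    unfolding codiscrete_submodule_iff
  proof (intro conjI allI impI U_sub U_open)
    fix T assume T: "submodule M T \<and> finite (coset M U ` T)"
    then have "finite (coset M L ` T)"
      using finite_coset_image_supset[OF U_sub L_sub U_L] submodule_subset by blast
    then have "T \<subseteq> L" using L T by (intro codiscrete_submodule_upper) simp_all
    then show "T \<subseteq> U"
      using T
      by (intro L.codiscrete_submodule_upper[OF U]) (simp_all add: submodule_submod_iff[OF L_sub])
  qed
qed

lemma codiscrete_submodule_Union_cosets:
  assumes W: "submodule M W" "closedin (top M) W" and S: "codiscrete_submodule (quot M W) S"
  shows "codiscrete_submodule M (\<Union>S)"
proof -
  interpret Q: topological_module "quot M W" using W by (rule topological_module_quot)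
  have S_sub: "submodule (quot M W) S" using S by (simp add: codiscrete_submodule_def)
  show ?thesis
    unfolding codiscrete_submodule_iff
  proof (intro conjI allI impI)
    show "submodule M (\<Union>S)" using W(1) S_sub by (rule submodule_Union_cosets)
    show "openin (top M) (\<Union>S)"
      using S openin_quot_iff[OF W(1)] by (simp add: codiscrete_submodule_def)
    fix T assume T: "submodule M T \<and> finite (coset M (\<Union>S) ` T)"
    then have "finite (coset (quot M W) S ` coset M W ` T)"
      by (intro finite_coset_quot_image W(1) S_sub submodule_subset) simp_all
    then have "coset M W ` T \<subseteq> S"
      using T by (intro Q.codiscrete_submodule_upper[OF S] submodule_quot_image W(1)) simp_all
    then show "T \<subseteq> \<Union>S" using T submodule_carrier_mem[of M T] self_mem_coset[OF W(1)] by blast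
  qed
qed

lemma compact_parafinite_submodule_Union_cosets:
  assumes W: "compact_parafinite_submodule M W" and S: "compact_parafinite_submodule (quot M W) S"
  shows "compact_parafinite_submodule M (\<Union>S)"
proof -
  have W_sub: "submodule M W" and W_compact: "compactin (top M) W"
    using W by (simp_all add: compact_parafinite_submodule_iff)
  interpret Q: topological_module "quot M W"
    using W_sub compactin_imp_closedin[OF Hausdorff W_compact] by (rule topological_module_quot)
  have S_sub: "submodule (quot M W) S" and S_compact: "compactin (top (quot M W)) S"
    using S by (simp_all add: Q.compact_parafinite_submodule_iff)
  have W_S: "W \<subseteq> \<Union>S" using S_sub by (rule subset_Union_cosets)
  note S_image = coset_image_Union[OF W_sub submodule_subset[OF S_sub]]
  show ?thesis
    unfolding compact_parafinite_submodule_iff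
  proof (intro conjI allI impI)
    show Union_sub: "submodule M (\<Union>S)" using W_sub S_sub by (rule submodule_Union_cosets)
    show "compactin (top M) (\<Union>S)" using W_sub W_compact S_compact by (rule compactin_Union_cosets)
    fix U assume U: "submodule M U \<and> closedin (top M) U \<and> finite (coset M U ` \<Union>S)"
    have "finite (coset M U ` W)" using U image_mono[OF W_S] by (meson finite_subset)
    then have "W \<subseteq> U" using U by (intro compact_parafinite_submodule_subset[OF W]) simp_all
    then have U_eq: "\<Union>(coset M W ` U) = U"
      using U W_sub by (intro Union_coset_image_submodule) simp_all
    let ?U = "coset M W ` U"
    have U_image_sub: "submodule (quot M W) ?U" using U by (intro submodule_quot_image W_sub) simp
    moreover have "closedin (top (quot M W)) ?U"
      using U proper_imp_closed_map[OF proper_map_coset[OF W_sub W_compact]]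
      by (simp add: closed_map_def)
    moreover have "finite (coset (quot M W) ?U ` S)"
      using U finite_coset_quot_image[OF W_sub U_image_sub submodule_subset[OF Union_sub]]
      unfolding U_eq S_image by simp
    ultimately have "S \<subseteq> ?U" by (rule Q.compact_parafinite_submodule_subset[OF S])
    then have "\<Union>S \<subseteq> \<Union>?U" by (rule Union_mono)
    then show "\<Union>S \<subseteq> U" unfolding U_eq .
  qed
qed

section \<open>The radicals\<close>

lemma Omega_sharp_eq_Inter: "Omega_sharp M = \<Inter>{U. codiscrete_submodule M U}"
  unfolding Omega_sharp_def codiscrete_submodule_def ..

lemma Omega_sharp_lower: "codiscrete_submodule M U \<Longrightarrow> Omega_sharp M \<subseteq> U"
  unfolding Omega_sharp_eq_Inter by blast

lemma submodule_Omega_sharp: "submodule M (Omega_sharp M)"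
  unfolding Omega_sharp_eq_Inter using codiscrete_submodule_carrier
  by (intro submodule_Inter) (auto simp: codiscrete_submodule_def)

lemma submodule_Union_compact_parafinite: "submodule M (\<Union>{N. compact_parafinite_submodule M N})"
proof (rule submodule_directed_Union)
  let ?\<F> = "{N. compact_parafinite_submodule M N}"
  show "?\<F> \<noteq> {}" using compact_parafinite_submodule_zero by blast
  show sub: "submodule M N" if "N \<in> ?\<F>" for N
    using that by (simp add: compact_parafinite_submodule_def)
  fix N L assume submodules: "N \<in> ?\<F>" "L \<in> ?\<F>"
  then have "N \<union> L \<subseteq> N \<^bold>+ L" by (intro Un_subset_sumset sub)
  moreover have "N \<^bold>+ L \<in> ?\<F>" using submodules by (simp add: compact_parafinite_submodule_sumset)
  ultimately show "\<exists>K\<in>?\<F>. N \<union> L \<subseteq> K" by blast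
qed

lemma W_flat_eq_Union: "W_flat M = \<Union>{N. compact_parafinite_submodule M N}"
proof
  show "W_flat M \<subseteq> \<Union>{N. compact_parafinite_submodule M N}"
    unfolding W_flat_def using submodule_Union_compact_parafinite
    by (intro Inter_lower) (auto simp: compact_parafinite_submodule_def)
  show "\<Union>{N. compact_parafinite_submodule M N} \<subseteq> W_flat M"
    unfolding W_flat_def by (auto simp: compact_parafinite_submodule_def)
qed

lemma W_flat_upper: "compact_parafinite_submodule M N \<Longrightarrow> N \<subseteq> W_flat M"
  unfolding W_flat_eq_Union by blast

lemma submodule_W_flat: "submodule M (W_flat M)"
  unfolding W_flat_eq_Union by (rule submodule_Union_compact_parafinite)

lemma W_flat_subset_Omega_sharp: "W_flat M \<subseteq> Omega_sharp M"
  unfolding W_flat_eq_Union Omega_sharp_eq_Inter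
  using compact_parafinite_submodule_subset_codiscrete by blast

lemma ex_codiscrete_submodule_Int_subset:
  assumes V: "compactin (top M) V" and G: "openin (top M) G" "Omega_sharp M \<subseteq> G"
  obtains U where "codiscrete_submodule M U" "V \<inter> U \<subseteq> G"
proof -
  let ?\<F> = "{U. codiscrete_submodule M U}"
  have cover: "V \<subseteq> (\<Union>U\<in>?\<F>. G \<union> (carrier M - U))"
    using G(2) compactin_subset_carrier[OF V] codiscrete_submodule_carrier
    unfolding Omega_sharp_eq_Inter by blast
  obtain U where "U \<in> ?\<F>" "V \<subseteq> G \<union> (carrier M - U)"
  proof (rule compactin_subset_directed_UN[OF V _ _ cover])
    show "?\<F> \<noteq> {}" using codiscrete_submodule_carrier by blast
    show "openin (top M) (G \<union> (carrier M - U))" if "U \<in> ?\<F>" for U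
      using that G(1) closedin_open_submodule[of U]
      by (auto simp: codiscrete_submodule_def closedin_def)
    fix U T assume "U \<in> ?\<F>" "T \<in> ?\<F>"
    then have "U \<inter> T \<in> ?\<F>" using codiscrete_submodule_Int by blast
    then show "\<exists>L\<in>?\<F>. (G \<union> (carrier M - U)) \<union> (G \<union> (carrier M - T)) \<subseteq> G \<union> (carrier M - L)" by blast
  qed
  then show ?thesis using that by blast
qed

lemma ex_compact_parafinite_submodule_subset_sumset:
  assumes S: "compactin (top M) S" and P: "openin (top M) P" and sub: "S \<subseteq> W_flat M \<^bold>+ P"
  obtains N where "compact_parafinite_submodule M N" "S \<subseteq> N \<^bold>+ P"
proof -
  let ?\<F> = "{N. compact_parafinite_submodule M N}"
  have submodule: "submodule M N" if "N \<in> ?\<F>" for N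
    using that by (simp add: compact_parafinite_submodule_def)
  have cover: "S \<subseteq> (\<Union>N\<in>?\<F>. N \<^bold>+ P)"
    using sub unfolding W_flat_eq_Union Union_sumset .
  obtain N where "N \<in> ?\<F>" "S \<subseteq> N \<^bold>+ P"
  proof (rule compactin_subset_directed_UN[OF S _ _ cover])
    show "?\<F> \<noteq> {}" using compact_parafinite_submodule_zero by blast
    show "openin (top M) (N \<^bold>+ P)" if "N \<in> ?\<F>" for N
      using P by (intro openin_sumset submodule_subset submodule that)
    fix N L assume submodules: "N \<in> ?\<F>" "L \<in> ?\<F>"
    then have "N \<union> L \<subseteq> N \<^bold>+ L" by (intro Un_subset_sumset submodule)
    then have "(N \<^bold>+ P) \<union> (L \<^bold>+ P) \<subseteq> (N \<^bold>+ L) \<^bold>+ P" by (simp add: sumset_mono_left)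
    moreover have "N \<^bold>+ L \<in> ?\<F>" using submodules by (simp add: compact_parafinite_submodule_sumset)
    ultimately show "\<exists>K\<in>?\<F>. (N \<^bold>+ P) \<union> (L \<^bold>+ P) \<subseteq> K \<^bold>+ P" by blast
  qed
  then show ?thesis using that by blast
qed

lemma W_flat_submod:
  assumes L: "submodule M L" "W_flat M \<subseteq> L"
  shows "W_flat (submod M L) = W_flat M"
proof -
  interpret L: topological_module "submod M L" using L(1) by (rule topological_module_submod)
  have "compact_parafinite_submodule (submod M L) = compact_parafinite_submodule M"
    using L(2) W_flat_upper compact_parafinite_submodule_submod_iff[OF L(1)] by blast
  then show ?thesis unfolding L.W_flat_eq_Union W_flat_eq_Union by simp
qed

lemma Omega_sharp_submod_self:
  assumes "codiscrete_submodule M (Omega_sharp M)"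
  shows "Omega_sharp (submod M (Omega_sharp M)) = Omega_sharp M"
proof -
  interpret L: topological_module "submod M (Omega_sharp M)"
    using submodule_Omega_sharp by (rule topological_module_submod)
  show ?thesis
  proof
    show "Omega_sharp (submod M (Omega_sharp M)) \<subseteq> Omega_sharp M"
      using submodule_subset[OF L.submodule_Omega_sharp] by simp
    show "Omega_sharp M \<subseteq> Omega_sharp (submod M (Omega_sharp M))"
      unfolding L.Omega_sharp_eq_Inter
      using Omega_sharp_lower codiscrete_submodule_trans[OF assms] by blast
  qed
qed

lemma W_flat_quot_self:
  assumes W: "compact_parafinite_submodule M (W_flat M)"
  shows "W_flat (quot M (W_flat M)) = {zero (quot M (W_flat M))}"
proof -
  have "compactin (top M) (W_flat M)" using W by (simp add: compact_parafinite_submodule_iff)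
  then interpret Q: topological_module "quot M (W_flat M)"
    by (intro topological_module_quot submodule_W_flat compactin_imp_closedin Hausdorff)
  have "S \<subseteq> {W_flat M}" if S: "compact_parafinite_submodule (quot M (W_flat M)) S" for S
  proof -
    have S_sub: "submodule (quot M (W_flat M)) S"
      using S by (simp add: compact_parafinite_submodule_def)
    have "\<Union>S \<subseteq> W_flat M"
      using compact_parafinite_submodule_Union_cosets[OF W S] by (rule W_flat_upper)
    then have "coset M (W_flat M) ` \<Union>S \<subseteq> {W_flat M}"
      using coset_eq_self_iff[OF submodule_W_flat] submodule_carrier_mem[OF submodule_W_flat]
      by blast
    then show ?thesis
      unfolding coset_image_Union[OF submodule_W_flat submodule_subset[OF S_sub]] .
  qed
  then have "W_flat (quot M (W_flat M)) \<subseteq> {W_flat M}" unfolding Q.W_flat_eq_Union by blast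
  then show ?thesis using submodule_zero_mem[OF Q.submodule_W_flat] by auto
qed

lemma Omega_sharp_quot_eq_carrier:
  assumes W: "submodule M W" "closedin (top M) W" and "Omega_sharp M = carrier M"
  shows "Omega_sharp (quot M W) = carrier (quot M W)"
proof -
  interpret Q: topological_module "quot M W" using W by (rule topological_module_quot)
  have "carrier (quot M W) \<subseteq> S" if S: "codiscrete_submodule (quot M W) S" for S
  proof -
    have "carrier M \<subseteq> \<Union>S"
      using Omega_sharp_lower[OF codiscrete_submodule_Union_cosets[OF W S]] assms(3) by simp
    moreover have "submodule (quot M W) S" using S by (simp add: codiscrete_submodule_def)
    ultimately show ?thesis using coset_image_Union[OF W(1) submodule_subset] by fastforce
  qed
  then show ?thesis
    using submodule_subset[OF Q.submodule_Omega_sharp] unfolding Q.Omega_sharp_eq_Inter by blast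
qed

lemma sheer_quot_W_flat:
  assumes W: "compact_parafinite_submodule M (W_flat M)" and "Omega_sharp M = carrier M"
  shows "sheer (quot M (W_flat M))"
proof -
  have "closedin (top M) (W_flat M)"
    using W by (simp add: compact_parafinite_submodule_iff compactin_imp_closedin[OF Hausdorff])
  then show ?thesis
    unfolding sheer_def
    using W_flat_quot_self[OF W] Omega_sharp_quot_eq_carrier[OF submodule_W_flat] assms(2) by simp
qed

lemma sheer_subquotient:
  assumes W: "compact_parafinite_submodule M (W_flat M)"
    and Omega: "codiscrete_submodule M (Omega_sharp M)"
  shows "sheer (quot (submod M (Omega_sharp M)) (W_flat M))"
proof -
  interpret L: topological_module "submod M (Omega_sharp M)"
    using submodule_Omega_sharp by (rule topological_module_submod)
  have W_eq: "W_flat (submod M (Omega_sharp M)) = W_flat M"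
    using submodule_Omega_sharp W_flat_subset_Omega_sharp by (rule W_flat_submod)
  have "compact_parafinite_submodule (submod M (Omega_sharp M)) (W_flat M)"
    using W W_flat_subset_Omega_sharp
    by (simp add: compact_parafinite_submodule_submod_iff[OF submodule_Omega_sharp])
  then show ?thesis
    using L.sheer_quot_W_flat Omega_sharp_submod_self[OF Omega] unfolding W_eq by simp
qed

end

section \<open>Compactly generated acting groups\<close>

lemma compactly_generatedE:
  assumes "compactly_generated TYPE('b::topological_ab_group_add)"
  obtains K :: "'b::topological_ab_group_add set"
  where "compact K" "uminus ` K = K" "gen_subgroup K = UNIV"
proof -
  obtain K :: "'b set" where K: "compact K" "gen_subgroup K = UNIV"
    using assms unfolding compactly_generated_def by metis
  have "gen_subgroup K \<subseteq> gen_subgroup (K \<union> uminus ` K)"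
    unfolding gen_subgroup_def by (intro Inter_anti_mono) auto
  then have "gen_subgroup (K \<union> uminus ` K) = UNIV" using K(2) by auto
  moreover have "compact (K \<union> uminus ` K)"
    using K(1) by (intro compact_Un compact_continuous_image continuous_on_minus continuous_on_id)
  moreover have "uminus ` (K \<union> uminus ` K) = K \<union> uminus ` K" by (auto simp: image_Un image_image)
  ultimately show ?thesis using that by metis
qed

locale compactly_generated_LC_module = topological_module M
  for M :: "('a, 'b::{topological_ab_group_add, t2_space}) lcmod" +
  assumes locally_compact: "locally_compact_space (top M)"
    and compactly_generated: "compactly_generated TYPE('b)"
begin

lemma ex_compact_nbhd_submodule_sumset:
  obtains Q V P where "openin (top M) Q" "\<zero> \<in> Q" "Q \<subseteq> V" "compactin (top M) V"
    "openin (top M) P" "\<zero> \<in> P"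
    "\<And>N L. submodule M N \<Longrightarrow> submodule M L \<Longrightarrow> N \<subseteq> L \<Longrightarrow> V \<inter> L \<subseteq> N \<^bold>+ P \<Longrightarrow>
      submodule M (N \<^bold>+ (V \<inter> L))"
proof -
  have "\<zero> \<in> topspace (top M)" by simp
  then obtain Q V where nbhd: "openin (top M) Q" "compactin (top M) V" "\<zero> \<in> Q" "Q \<subseteq> V"
    using locally_compact unfolding locally_compact_space_def by meson
  obtain K :: "'b set" where K: "compact K" "uminus ` K = K" "gen_subgroup K = UNIV"
    using compactly_generated by (rule compactly_generatedE)
  obtain P where P: "openin (top M) P" "\<zero> \<in> P"
    "\<And>x y. x \<in> P \<Longrightarrow> y \<in> P \<Longrightarrow> x \<oplus> y \<in> Q" "\<And>x. x \<in> P \<Longrightarrow> \<ominus> x \<in> Q"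
    "\<And>a x. a \<in> K \<Longrightarrow> x \<in> P \<Longrightarrow> a \<cdot> x \<in> Q"
    using ex_small_nbhd_zero[OF nbhd(1,3) K(1)] by metis
  show ?thesis
  proof (rule that[OF nbhd(1,3,4,2) P(1,2)])
    fix N L assume submodules: "submodule M N" "submodule M L" "N \<subseteq> L" and cover: "V \<inter> L \<subseteq> N \<^bold>+ P"
    have P_carrier: "P \<subseteq> carrier M" using P(1) by (rule openin_subset_carrier)
    show "submodule M (N \<^bold>+ (V \<inter> L))"
    proof (rule submodule_sumset_if_small[where T = "P \<inter> L", OF K(3,2) submodules(1)])
      show "V \<inter> L \<subseteq> carrier M" using compactin_subset_carrier[OF nbhd(2)] by blast
      show "\<zero> \<in> V \<inter> L" using nbhd(3,4) submodule_zero_mem[OF submodules(2)] by blast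
      show "V \<inter> L \<subseteq> N \<^bold>+ (P \<inter> L)" using cover sumset_Int_modular[OF submodules P_carrier] by blast
      show "P \<inter> L \<subseteq> carrier M" using P_carrier by blast
    qed (use P(3-5) nbhd(4) submodules(2) in \<open>auto simp: submodule_mems\<close>)
  qed
qed

lemma openin_Omega_sharp: "openin (top M) (Omega_sharp M)"
proof -
  let ?\<Omega> = "Omega_sharp M"
  note \<Omega> = submodule_Omega_sharp
  obtain Q V P where Q: "openin (top M) Q" "\<zero> \<in> Q" "Q \<subseteq> V" and V: "compactin (top M) V"
    and P: "openin (top M) P" "\<zero> \<in> P"
    and sum: "\<And>N L. submodule M N \<Longrightarrow> submodule M L \<Longrightarrow> N \<subseteq> L \<Longrightarrow> V \<inter> L \<subseteq> N \<^bold>+ P \<Longrightarrow>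
      submodule M (N \<^bold>+ (V \<inter> L))"
    using ex_compact_nbhd_submodule_sumset by metis
  have V_carrier: "V \<subseteq> carrier M" using V by (rule compactin_subset_carrier)
  have "openin (top M) (?\<Omega> \<^bold>+ P)" "?\<Omega> \<subseteq> ?\<Omega> \<^bold>+ P"
    using submodule_subset[OF \<Omega>] P by (simp_all add: openin_sumset sumset_upper1)
  then obtain L where L: "codiscrete_submodule M L" and cover: "V \<inter> L \<subseteq> ?\<Omega> \<^bold>+ P"
    using ex_codiscrete_submodule_Int_subset[OF V] by blast
  let ?H = "?\<Omega> \<^bold>+ (V \<inter> L)"
  have H: "submodule M ?H"
    using L cover Omega_sharp_lower[OF L] by (intro sum \<Omega>) (simp_all add: codiscrete_submodule_def)
  have "?H \<subseteq> U" if U: "codiscrete_submodule M U" for U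
  proof -
    have U_sub: "submodule M U" and U_open: "openin (top M) U"
      using U by (simp_all add: codiscrete_submodule_def)
    have "coset M U ` ?H \<subseteq> coset M U ` (V \<inter> L)"
      using V_carrier Omega_sharp_lower[OF U] by (intro coset_image_sumset_subset U_sub) auto
    then have "coset M U ` ?H \<subseteq> coset M U ` V" by blast
    moreover have "finite (coset M U ` V)"
      using U_sub U_open submodule_zero_mem[OF U_sub] by (intro finite_coset_image_compactin[OF V])
    ultimately show "?H \<subseteq> U"
      using U H by (intro codiscrete_submodule_upper) (auto intro: finite_subset)
  qed
  then have "?H \<subseteq> ?\<Omega>" unfolding Omega_sharp_eq_Inter by blast
  moreover have "V \<inter> L \<subseteq> ?H" using submodule_zero_mem[OF \<Omega>] V_carrier by (intro sumset_upper2) auto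
  ultimately have "Q \<inter> L \<subseteq> ?\<Omega>" using Q(3) by blast
  moreover have "openin (top M) (Q \<inter> L)" "\<zero> \<in> Q \<inter> L"
    using Q(1,2) L submodule_zero_mem[of M L] by (auto simp: codiscrete_submodule_def)
  ultimately show ?thesis by (intro openin_submoduleI[OF \<Omega>])
qed

lemma codiscrete_submodule_Omega_sharp: "codiscrete_submodule M (Omega_sharp M)"
  using codiscrete_submodule_Inter[of "{U. codiscrete_submodule M U}"]
    codiscrete_submodule_carrier openin_Omega_sharp
  unfolding Omega_sharp_eq_Inter by blast

lemma compactin_closure_of_W_flat: "compactin (top M) (top M closure_of W_flat M)"
proof -
  let ?L = "top M closure_of W_flat M"
  have L: "submodule M ?L" using submodule_W_flat by (rule submodule_closure_of)
  have W_L: "W_flat M \<subseteq> ?L" using submodule_W_flat by (rule submodule_subset_closure_of)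
  obtain Q V P where Q: "openin (top M) Q" "\<zero> \<in> Q" "Q \<subseteq> V" and V: "compactin (top M) V"
    and P: "openin (top M) P" "\<zero> \<in> P"
    and sum: "\<And>N L. submodule M N \<Longrightarrow> submodule M L \<Longrightarrow> N \<subseteq> L \<Longrightarrow> V \<inter> L \<subseteq> N \<^bold>+ P \<Longrightarrow>
      submodule M (N \<^bold>+ (V \<inter> L))"
    using ex_compact_nbhd_submodule_sumset by metis
  have VL_compact: "compactin (top M) (V \<inter> ?L)" using V by (rule compact_Int_closedin) simp
  have "V \<inter> ?L \<subseteq> W_flat M \<^bold>+ P"
    using closure_of_subset_sumset[OF submodule_subset[OF submodule_W_flat] P] by blast
  then obtain N where N: "compact_parafinite_submodule M N" and cover: "V \<inter> ?L \<subseteq> N \<^bold>+ P"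
    using ex_compact_parafinite_submodule_subset_sumset[OF VL_compact P(1)] by blast
  let ?H = "N \<^bold>+ (V \<inter> ?L)"
  have N_sub: "submodule M N" and N_compact: "compactin (top M) N"
    using N by (simp_all add: compact_parafinite_submodule_iff)
  have H: "submodule M ?H" using W_L W_flat_upper[OF N] by (intro sum N_sub L cover) blast
  have H_compact: "compactin (top M) ?H" using N_compact VL_compact by (rule compactin_sumset)
  then have H_closed: "closedin (top M) ?H" by (rule compactin_imp_closedin[OF Hausdorff])
  have VL_H: "V \<inter> ?L \<subseteq> ?H"
    using submodule_zero_mem[OF N_sub] compactin_subset_carrier[OF VL_compact]
    by (rule sumset_upper2)
  have "K \<subseteq> ?H" if K: "compact_parafinite_submodule M K" for K
    using Q(3) VL_H W_flat_upper[OF K] W_L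
    by (intro compact_parafinite_submodule_subset_nbhd[OF K H H_closed Q(1,2)]) blast
  then have "W_flat M \<subseteq> ?H" unfolding W_flat_eq_Union by blast
  then have "?L \<subseteq> ?H" using H_closed by (rule closure_of_minimal)
  with H_compact show ?thesis by (rule closed_compactin) simp
qed

lemma compact_parafinite_submodule_W_flat: "compact_parafinite_submodule M (W_flat M)"
proof -
  let ?L = "top M closure_of W_flat M"
  have W_L: "W_flat M \<subseteq> ?L" using submodule_W_flat by (rule submodule_subset_closure_of)
  have "compact_parafinite_submodule M ?L"
  proof (rule compact_parafinite_submodule_hull)
    show "submodule M ?L" using submodule_W_flat by (rule submodule_closure_of)
    show "compactin (top M) ?L" by (rule compactin_closure_of_W_flat)
    show "compact_parafinite_submodule M N \<and> N \<subseteq> ?L"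
      if "N \<in> {N. compact_parafinite_submodule M N}" for N
      using that W_flat_upper W_L by blast
    show "?L \<subseteq> U" if "closedin (top M) U" "\<Union>{N. compact_parafinite_submodule M N} \<subseteq> U" for U
      using that unfolding W_flat_eq_Union[symmetric] by (intro closure_of_minimal)
  qed
  moreover from this have "?L = W_flat M" using W_flat_upper W_L by blast
  ultimately show ?thesis by simp
qed

end

lemma LC_module_imp_topological_module: "LC_module M \<Longrightarrow> topological_module M"
  unfolding LC_module_def topological_abgroup_def by unfold_locales blast+

theorem mainTheorem2:
  fixes M :: "('a, 'b::{topological_ab_group_add, t2_space}) lcmod"
  assumes "LCA_type TYPE('b)"
    and "LC_module M"
  shows "{zero M} \<subseteq> W_flat M \<and> W_flat M \<subseteq> Omega_sharp M \<and> Omega_sharp M \<subseteq> carrier M \<and>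
           (compactly_generated TYPE('b) \<longrightarrow>
           submodule M (W_flat M) \<and> compact_parafinite (submod M (W_flat M)) \<and>
           submodule M (Omega_sharp M) \<and> openin (top M) (Omega_sharp M) \<and>
           purely_discrete (quot M (Omega_sharp M)) \<and>
           sheer (quot (submod M (Omega_sharp M)) (W_flat M)))"
proof -
  interpret topological_module M using assms(2) by (rule LC_module_imp_topological_module)
  have chain: "{zero M} \<subseteq> W_flat M" "W_flat M \<subseteq> Omega_sharp M" "Omega_sharp M \<subseteq> carrier M"
    using submodule_zero_mem[OF submodule_W_flat] W_flat_subset_Omega_sharp
      submodule_subset[OF submodule_Omega_sharp] by simp_all
  have "compact_parafinite_submodule M (W_flat M) \<and> codiscrete_submodule M (Omega_sharp M) \<and>
      sheer (quot (submod M (Omega_sharp M)) (W_flat M))" if "compactly_generated TYPE('b)"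
  proof -
    interpret compactly_generated_LC_module M
      using assms(2) that by unfold_locales (simp_all add: LC_module_def)
    show ?thesis
      using compact_parafinite_submodule_W_flat codiscrete_submodule_Omega_sharp sheer_subquotient
      by simp
  qed
  then show ?thesis
    using chain unfolding compact_parafinite_submodule_def codiscrete_submodule_def by blast
qed

end
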